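(* Let $d\ge 1$ and let $\{\xi(z):z\in\mathbb{Z}^d\}$ be independent identically distributed random variables with distribution function $F(x)=P(\xi(0)\le x)=1-e^{-x^\gamma}$ for $x\ge 0$ (and $F(x)=0$ for $x<0$), for some $0<\gamma<1$. Let $U(t)$ be the total mass of the solution of the parabolic Anderson problem with potential $\xi$ and localized initial condition, and let $L_t=\frac1t\log U(t)$. Then, almost surely, $$\limsup_{t\to\infty}\frac{L_t-(d\log t)^{1/\gamma}}{(d\log t)^{1/\gamma-1}\log\log t}=d\left(\frac1{\gamma^2}-\frac1\gamma\right)+\frac1\gamma,$$ $$\liminf_{t\to\infty}\frac{L_t-(d\log t)^{1/\gamma}}{(d\log t)^{1/\gamma-1}\log\log t}=d\left(\frac1{\gamma^2}-\frac1\gamma\right).$$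
   Context: The parabolic Anderson problem is the Cauchy problem $\partial_t u(t,z)=\Delta^{\mathrm d}u(t,z)+\xi(z)u(t,z)$ for $(t,z)\in(0,\infty)\times\mathbb{Z}^d$, $u(0,z)=\mathbf 1_0(z)$, where $(\Delta^{\mathrm d}f)(z)=\sum_{y\sim z}[f(y)-f(z)]$ is the discrete Laplacian (sum over the $2d$ nearest neighbours of $z$). For the potentials considered here it almost surely has a unique nonnegative solution $u$; its total mass is $U(t)=\sum_{z\in\mathbb{Z}^d}u(t,z)$. By the Feynman–Kac formula, $U(t)=\mathbb{E}_0[\exp\{\int_0^t\xi(X_s)\,ds\}]$, where $(X_s)_{s\ge0}$ is the continuous-time simple random walk on $\mathbb{Z}^d$ with generator $\Delta^{\mathrm d}$ (total jump rate $2d$), independent of $\xi$, started at $0$, and $\mathbb{E}_0$ denotes expectation over the walk only. *)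

theory Defs
  imports "HOL-Probability.Probability"
begin

text \<open>The lattice \<open>\<int>\<^sup>d\<close> is the type \<^typ>\<open>int ^ 'n\<close>, with \<open>d = CARD('n) \<ge> 1\<close>.\<close>

definition lattice_neighbours :: "int ^ 'n \<Rightarrow> (int ^ 'n) set" where
  "lattice_neighbours z = {y. (\<Sum>i\<in>UNIV. \<bar>y $ i - z $ i\<bar>) = 1}"

definition discrete_laplacian :: "(int ^ 'n \<Rightarrow> real) \<Rightarrow> int ^ 'n \<Rightarrow> real" where
  "discrete_laplacian f z = (\<Sum>y\<in>lattice_neighbours z. f y - f z)"

text \<open>
  Classical nonnegative solutions of the parabolic Anderson problem with potential \<open>V\<close>, started
  from the indicator of the origin. The initial condition is attained continuously. The last
  conjunct is only a convention: the problem says nothing about \<open>t < 0\<close>, and fixing the junk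
  values there makes ``the unique solution'' meaningful for the total type \<^typ>\<open>real\<close>.
\<close>

definition pam_solution :: "(int ^ 'n \<Rightarrow> real) \<Rightarrow> (real \<Rightarrow> int ^ 'n \<Rightarrow> real) \<Rightarrow> bool" where
  "pam_solution V u \<longleftrightarrow>
     (\<forall>t>0. \<forall>z. ((\<lambda>s. u s z) has_real_derivative
                    (discrete_laplacian (u t) z + V z * u t z)) (at t)) \<and>
     (\<forall>z. u 0 z = indicator {0} z) \<and>
     (\<forall>z. continuous_on {0..} (\<lambda>t. u t z)) \<and>
     (\<forall>t\<ge>0. \<forall>z. 0 \<le> u t z) \<and>
     (\<forall>t<0. \<forall>z. u t z = 0)"

definition pam :: "(int ^ 'n \<Rightarrow> real) \<Rightarrow> real \<Rightarrow> int ^ 'n \<Rightarrow> real" where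
  "pam V = (THE u. pam_solution V u)"

definition pam_total_mass :: "(int ^ 'n \<Rightarrow> real) \<Rightarrow> real \<Rightarrow> real" where
  "pam_total_mass V t = (\<Sum>\<^sub>\<infinity>z. pam V t z)"

definition pam_growth :: "(int ^ 'n \<Rightarrow> real) \<Rightarrow> real \<Rightarrow> real" where
  "pam_growth V t = ln (pam_total_mass V t) / t"

lemma lattice_neighbours_eq:
  "lattice_neighbours (z :: int ^ 'n) = (\<lambda>(i, s). z + axis i s) ` (UNIV \<times> {1, -1})"
proof (intro equalityI subsetI)
  fix y assume "y \<in> lattice_neighbours z"
  then have s: "(\<Sum>i\<in>UNIV. \<bar>y $ i - z $ i\<bar>) = 1"
    by (simp add: lattice_neighbours_def)
  then obtain k where k: "y $ k \<noteq> z $ k"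
    by (cases "\<forall>k. y $ k = z $ k") auto
  have split: "\<bar>y $ k - z $ k\<bar> + (\<Sum>i\<in>UNIV - {k}. \<bar>y $ i - z $ i\<bar>) = 1"
    using s sum.remove[of UNIV k "\<lambda>i. \<bar>y $ i - z $ i\<bar>"] by simp
  have nn: "0 \<le> (\<Sum>i\<in>UNIV - {k}. \<bar>y $ i - z $ i\<bar>)"
    by (simp add: sum_nonneg)
  have one: "\<bar>y $ k - z $ k\<bar> = 1" and rest: "(\<Sum>i\<in>UNIV - {k}. \<bar>y $ i - z $ i\<bar>) = 0"
    using split nn k by linarith+
  from rest have "\<forall>i\<in>UNIV - {k}. \<bar>y $ i - z $ i\<bar> = 0"
    by (subst (asm) sum_nonneg_eq_0_iff) auto
  then have "y = z + axis k (y $ k - z $ k)"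
    by (auto simp: vec_eq_iff axis_def)
  moreover have "y $ k - z $ k \<in> {1, -1}"
    using one by auto
  ultimately show "y \<in> (\<lambda>(i, s). z + axis i s) ` (UNIV \<times> {1, -1})"
    by (intro image_eqI[where x = "(k, y $ k - z $ k)"]) auto
next
  fix y assume "y \<in> (\<lambda>(i, s). z + axis i s) ` (UNIV \<times> {1, -1})"
  then obtain k s where y: "y = z + axis k s" and s: "s = 1 \<or> s = -1"
    by auto
  have "(\<Sum>i\<in>UNIV. \<bar>y $ i - z $ i\<bar>) = (\<Sum>i\<in>UNIV. if i = k then 1 else 0)"
    using s by (intro sum.cong) (auto simp: y axis_def)
  then show "y \<in> lattice_neighbours z"
    by (simp add: lattice_neighbours_def)
qed

lemma card_lattice_neighbours: "card (lattice_neighbours (z :: int ^ 'n)) = 2 * CARD('n)"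
proof -
  have "inj_on (\<lambda>(i, s). z + axis i s) (UNIV \<times> {1, -1 :: int})"
    by (auto simp: inj_on_def axis_eq_axis)
  then show ?thesis
    by (simp add: lattice_neighbours_eq card_image card_cartesian_product)
qed

end

theory Submission
  imports Defs "HOL-Real_Asymp.Real_Asymp"
begin

text \<open>
  Write \<open>a = 1 / \<gamma> > 1\<close>. The total mass is governed by a competition: the walk may travel to a
  site of high potential and stay there, at the price of reaching it quickly.

  The solution is \<open>exp (- 2 d t) \<cdot> \<Sum>\<^sub>k t\<^sup>k / k! \<cdot> B\<^sup>k \<delta>\<^sub>0\<close>, where \<open>B\<close> is the adjacency operator plus multiplication by
  the potential \<open>V\<close>. Its \<open>k\<close>-th coefficient is a sum over lazy lattice paths with \<open>k\<close> steps, in which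
  a jump has weight \<open>1\<close> and a pause at \<open>z\<close> has weight \<open>V z\<close>. This series replaces the Feynman-Kac
  formula throughout. Grouping paths by their number \<open>n\<close> of jumps gives
    \<open>U(t) \<le> exp (- 2 d t) \<cdot> \<Sum>\<^sub>n (2 d t)\<^sup>n / n! \<cdot> exp (t \<cdot> max {V z | \<bar>z\<bar> \<le> n})\<close>
  (\<open>pam_total_mass_le\<close>), and keeping only paths that walk straight to one site \<open>z\<close> and then stay gives
    \<open>U(t) \<ge> exp (t m - 2 d t - \<bar>z\<bar> ln m) / 2\<close> for \<open>1 \<le> m \<le> V z\<close> and \<open>t m\<close> large compared with \<open>\<bar>z\<bar>\<close>
  (\<open>pam_total_mass_ge\<close>). Since \<open>pam\<close> is a definite description, it has to be shown that the series is
  the only nonnegative solution (\<open>pam_eq\<close>); a Harnack inequality does this for potentials of at most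
  linear growth.

  In both bounds the cost of \<open>n\<close> jumps per unit of time is of order \<open>n / t\<close> up to factors \<open>ln ln t\<close>,
  while the potential within distance \<open>n\<close> exceeds \<open>(d ln t)\<^sup>a\<close> by the order
  \<open>(ln t) powr (a - 1) \<cdot> ln ln t\<close>. So the relevant radius is \<open>t (ln t) powr b\<close> with \<open>b\<close>
  arbitrarily close to \<open>a - 1\<close>: for \<open>b < a - 1\<close> the journey is free to the order considered
  (\<open>growth_ratio_ge\<close>), and beyond the radius with \<open>b > a - 1\<close> it never pays
  (\<open>far_sites_negligible\<close>, \<open>growth_ratio_le\<close>). Hence \<open>L\<^sub>t\<close> follows the maximum of the potential over
  a ball of radius \<open>r = t (ln t) powr b\<close>. If the \<open>\<gamma>\<close>-th power of this maximum is \<open>d ln r + \<kappa> ln ln r\<close>,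
  then a Taylor expansion of \<open>x powr a\<close> at \<open>d ln t\<close> turns this into the value \<open>a (d b + \<kappa>)\<close> of the
  normalised quantity.

  The \<open>\<gamma>\<close>-th powers of the field are independent standard exponential variables, so \<open>\<kappa>\<close> is a
  matter of Borel-Cantelli arguments along dyadic radii: almost surely the limit superior of \<open>\<kappa>\<close> is \<open>1\<close>
  (\<open>AE_eventually_below\<close>, \<open>AE_frequently_above\<close>) and its limit inferior is \<open>0\<close>
  (\<open>AE_eventually_above\<close>, \<open>AE_frequently_below\<close>). With \<open>b \<rightarrow> a - 1\<close> these are the two constants.
\<close>

section \<open>The lattice and its 1-norm\<close>

definition l1 :: "int ^ 'n \<Rightarrow> nat" where
  "l1 z = (\<Sum>i\<in>UNIV. nat \<bar>z $ i\<bar>)"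

lemma l1_zero [simp]: "l1 0 = 0"
  by (simp add: l1_def)

lemma l1_eq_0_iff: "l1 z = 0 \<longleftrightarrow> z = 0"
  by (auto simp: l1_def vec_eq_iff)

lemma abs_component_le_l1: "\<bar>z $ i\<bar> \<le> int (l1 z)"
proof -
  have "nat \<bar>z $ i\<bar> \<le> l1 z"
    unfolding l1_def by (rule member_le_sum) auto
  then show ?thesis by linarith
qed

lemma l1_triangle: "l1 (x + y) \<le> l1 x + l1 y"
  unfolding l1_def sum.distrib[symmetric] by (rule sum_mono) auto

lemma neighbour_iff_l1: "y \<in> lattice_neighbours z \<longleftrightarrow> l1 (y - z) = 1"
proof -
  have "int (l1 (y - z)) = (\<Sum>i\<in>UNIV. \<bar>y $ i - z $ i\<bar>)"
    by (simp add: l1_def)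
  then show ?thesis
    unfolding lattice_neighbours_def mem_Collect_eq by linarith
qed

lemma finite_lattice_neighbours [simp]: "finite (lattice_neighbours z)"
  by (simp add: lattice_neighbours_eq)

lemma l1_minus: "l1 (- z) = l1 z"
  by (simp add: l1_def)

lemma neighbour_sym: "y \<in> lattice_neighbours z \<longleftrightarrow> z \<in> lattice_neighbours y"
  using l1_minus[of "y - z"] by (simp add: neighbour_iff_l1)

lemma l1_neighbour_le:
  assumes "y \<in> lattice_neighbours z"
  shows "l1 (y - c) \<le> Suc (l1 (z - c))"
  using l1_triangle[of "y - z" "z - c"] assms by (simp add: neighbour_iff_l1)

lemma neighbour_towards:
  assumes "l1 (z - c) = Suc k"
  obtains y where "y \<in> lattice_neighbours z" "l1 (y - c) = k"
proof -
  have "z - c \<noteq> 0" using assms by auto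
  then obtain i where i: "(z - c) $ i \<noteq> 0"
    by (auto simp: vec_eq_iff)
  define y where "y = z - axis i (sgn ((z - c) $ i))"
  have s1: "l1 (y - z) = (\<Sum>j\<in>UNIV. if j = i then 1 else 0)"
    unfolding l1_def using i by (intro sum.cong) (auto simp: y_def axis_def sgn_if)
  then have nb: "y \<in> lattice_neighbours z"
    by (simp add: neighbour_iff_l1)
  have "l1 (z - c) = (\<Sum>j\<in>UNIV. nat \<bar>(y - c) $ j\<bar> + (if j = i then 1 else 0))"
    unfolding l1_def using i by (intro sum.cong) (auto simp: y_def axis_def sgn_if)
  also have "\<dots> = l1 (y - c) + 1"
    by (simp add: sum.distrib l1_def)
  finally show ?thesis using that nb assms by simp
qed

lemma card_vec_all_components:
  assumes "finite S"
  shows "finite {z :: 'a ^ 'n. \<forall>i. z $ i \<in> S}"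
    and "card {z :: 'a ^ 'n. \<forall>i. z $ i \<in> S} = card S ^ CARD('n)"
proof -
  have "bij_betw vec_nth {z :: 'a ^ 'n. \<forall>i. z $ i \<in> S} (PiE UNIV (\<lambda>_. S))"
    by (rule bij_betw_byWitness[where f' = vec_lambda]) auto
  then show "finite {z :: 'a ^ 'n. \<forall>i. z $ i \<in> S}"
      and "card {z :: 'a ^ 'n. \<forall>i. z $ i \<in> S} = card S ^ CARD('n)"
    using finite_PiE[of "UNIV :: 'n set" "\<lambda>_. S"] assms
    by (auto simp: bij_betw_finite bij_betw_same_card card_PiE)
qed

lemma
  shows finite_l1_ball [simp]: "finite {z :: int ^ 'n. l1 z \<le> n}"
    and card_l1_ball_le: "card {z :: int ^ 'n. l1 z \<le> n} \<le> (2 * n + 1) ^ CARD('n)"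
proof -
  let ?Q = "{z :: int ^ 'n. \<forall>i. z $ i \<in> {- int n..int n}}"
  have sub: "{z :: int ^ 'n. l1 z \<le> n} \<subseteq> ?Q"
  proof safe
    fix z :: "int ^ 'n" and i assume "l1 z \<le> n"
    then have "\<bar>z $ i\<bar> \<le> int n"
      using abs_component_le_l1[of z i] by linarith
    then show "z $ i \<in> {- int n..int n}"
      by (simp add: abs_le_iff)
  qed
  have fin: "finite ?Q" by (rule card_vec_all_components) simp
  show "finite {z :: int ^ 'n. l1 z \<le> n}"
    by (rule finite_subset[OF sub fin])
  have "card ?Q = card {- int n..int n} ^ CARD('n)"
    by (rule card_vec_all_components) simp
  also have "card {- int n..int n} = 2 * n + 1"
    by simp
  finally show "card {z :: int ^ 'n. l1 z \<le> n} \<le> (2 * n + 1) ^ CARD('n)"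
    using card_mono[OF fin sub] by simp
qed

definition peak :: "(int ^ 'n \<Rightarrow> real) \<Rightarrow> nat \<Rightarrow> real" where
  "peak V n = Max (V ` {z. l1 z \<le> n})"

lemma peak_ge: "l1 z \<le> n \<Longrightarrow> V z \<le> peak V n"
  unfolding peak_def by (rule Max_ge) auto

lemma l1_ball_nonempty: "{z. l1 z \<le> n} \<noteq> {}"
  by (metis (mono_tags) empty_iff l1_zero le0 mem_Collect_eq)

lemma peak_le_iff: "peak V n \<le> x \<longleftrightarrow> (\<forall>z. l1 z \<le> n \<longrightarrow> V z \<le> x)"
  unfolding peak_def using l1_ball_nonempty by (subst Max_le_iff) auto

lemma peak_mono: "m \<le> n \<Longrightarrow> peak V m \<le> peak V n"
  by (auto simp: peak_le_iff intro!: peak_ge)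

text \<open>
  Each site \<open>y\<close> is a neighbour of at most \<open>2 d\<close> sites of \<open>F\<close>: one jump multiplies the total weight by
  at most \<open>2 d\<close>.
\<close>

lemma sum_neighbours_le:
  fixes g :: "int ^ 'n \<Rightarrow> real"
  assumes "finite F" "finite G" and supp: "\<And>y. y \<notin> G \<Longrightarrow> g y = 0" and nn: "\<And>y. 0 \<le> g y"
  shows "(\<Sum>z\<in>F. \<Sum>y\<in>lattice_neighbours z. g y) \<le> 2 * real CARD('n) * (\<Sum>y\<in>G. g y)"
proof -
  have "(\<Sum>z\<in>F. \<Sum>y\<in>lattice_neighbours z. g y)
      = (\<Sum>z\<in>F. \<Sum>y\<in>{y \<in> G. y \<in> lattice_neighbours z}. g y)"
    using supp by (intro sum.cong[OF refl] sum.mono_neutral_right) auto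
  also have "\<dots> = (\<Sum>y\<in>G. \<Sum>z\<in>{z \<in> F. y \<in> lattice_neighbours z}. g y)"
    by (rule sum.swap_restrict) (use assms in auto)
  also have "\<dots> \<le> (\<Sum>y\<in>G. 2 * real CARD('n) * g y)"
  proof (rule sum_mono)
    fix y assume "y \<in> G"
    have "card {z \<in> F. y \<in> lattice_neighbours z} \<le> card (lattice_neighbours y)"
      by (rule card_mono) (auto simp: neighbour_sym)
    then have "real (card {z \<in> F. y \<in> lattice_neighbours z}) \<le> 2 * real CARD('n)"
      by (simp add: card_lattice_neighbours)
    then show "(\<Sum>z\<in>{z \<in> F. y \<in> lattice_neighbours z}. g y) \<le> 2 * real CARD('n) * g y"
      using nn[of y] by (simp add: mult_right_mono)
  qed
  finally show ?thesis by (simp add: sum_distrib_left)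
qed

section \<open>The power series solution\<close>

text \<open>
  The vector \<open>B\<^sup>k \<delta>\<^sub>0\<close> for \<open>B = adjacency + V\<close>. The diagonal term \<open>- 2 d\<close> of the Laplacian is left out, so
  that everything is nonnegative; it becomes the factor \<open>exp (- 2 d t)\<close> of the solution.
\<close>

primrec anderson_power :: "(int ^ 'n \<Rightarrow> real) \<Rightarrow> nat \<Rightarrow> int ^ 'n \<Rightarrow> real" where
  "anderson_power V 0 z = indicator {0} z"
| "anderson_power V (Suc k) z =
     V z * anderson_power V k z + (\<Sum>y\<in>lattice_neighbours z. anderson_power V k y)"

text \<open>
  The contribution to \<open>anderson_power V k z\<close> of the lazy paths with exactly \<open>n\<close> jumps. Such a path
  sees only the potential within distance \<open>n\<close> of the origin, however large \<open>k\<close> is; this is why the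
  number of jumps has to be recorded.
\<close>

primrec jump_power :: "(int ^ 'n \<Rightarrow> real) \<Rightarrow> nat \<Rightarrow> nat \<Rightarrow> int ^ 'n \<Rightarrow> real" where
  "jump_power V 0 n z = (if n = 0 then indicator {0} z else 0)"
| "jump_power V (Suc k) n z = V z * jump_power V k n z +
     (case n of 0 \<Rightarrow> 0 | Suc m \<Rightarrow> \<Sum>y\<in>lattice_neighbours z. jump_power V k m y)"

lemma jump_power_gt: "k < n \<Longrightarrow> jump_power V k n z = 0"
  by (induction k arbitrary: n z) (auto split: nat.split)

lemma jump_power_support: "n < l1 z \<Longrightarrow> jump_power V k n z = 0"
proof (induction k arbitrary: n z)
  case 0
  then show ?case by (auto simp: indicator_def)
next
  case (Suc k)
  have "jump_power V k m y = 0" if "n = Suc m" "y \<in> lattice_neighbours z" for m y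
  proof (rule Suc.IH)
    have "z \<in> lattice_neighbours y"
      using that neighbour_sym by blast
    then show "m < l1 y"
      using l1_neighbour_le[of z y 0] Suc.prems that by simp
  qed
  then show ?case using Suc by (auto split: nat.split)
qed

lemma anderson_power_eq_sum_jump_power:
  "anderson_power V k z = (\<Sum>n\<le>k. jump_power V k n z)"
proof (induction k arbitrary: z)
  case 0
  then show ?case by simp
next
  case (Suc k)
  have "(\<Sum>n\<le>Suc k. jump_power V (Suc k) n z)
      = V z * (\<Sum>n\<le>Suc k. jump_power V k n z)
        + (\<Sum>n\<le>Suc k. case n of 0 \<Rightarrow> 0 | Suc m \<Rightarrow> \<Sum>y\<in>lattice_neighbours z. jump_power V k m y)"
    by (simp add: sum.distrib sum_distrib_left distrib_left)
  also have "(\<Sum>n\<le>Suc k. jump_power V k n z) = anderson_power V k z"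
    by (simp add: Suc.IH jump_power_gt)
  also have "(\<Sum>n\<le>Suc k. case n of 0 \<Rightarrow> 0 | Suc m \<Rightarrow> \<Sum>y\<in>lattice_neighbours z. jump_power V k m y)
      = (\<Sum>m\<le>k. \<Sum>y\<in>lattice_neighbours z. jump_power V k m y)"
    by (subst sum.atMost_Suc_shift) simp
  also have "\<dots> = (\<Sum>y\<in>lattice_neighbours z. anderson_power V k y)"
    by (subst sum.swap) (simp add: Suc.IH)
  finally show ?case by simp
qed

lemma sum_exp_series_le:
  assumes "0 \<le> (x :: real)"
  shows "(\<Sum>j<n. x ^ j / fact j) \<le> exp x"
proof -
  have "(\<Sum>j<n. x ^ j / fact j) \<le> (\<Sum>j. x ^ j / fact j)"
    using summable_exp[of x] assms
    by (intro sum_le_suminf) (auto simp: field_simps)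
  then show ?thesis by (simp add: exp_def field_simps)
qed

text \<open>
  Under linear growth the maximum over a ball of radius \<open>n\<close> contributes at most a constant times
  \<open>exp (t K)\<^sup>n\<close>, which the \<open>n!\<close> in the weight \<open>(2 d t)\<^sup>n / n!\<close> of \<open>n\<close> jumps absorbs for every \<open>t\<close>.
\<close>

locale linear_potential =
  fixes V :: "int ^ 'n \<Rightarrow> real" and C K :: real
  assumes V_nonneg: "0 \<le> V z"
    and K_nonneg: "0 \<le> K"
    and V_le: "V z \<le> C + K * real (l1 z)"
begin

lemma anderson_power_nonneg: "0 \<le> anderson_power V k z"
  by (induction k arbitrary: z) (auto intro!: add_nonneg_nonneg mult_nonneg_nonneg sum_nonneg V_nonneg)

lemma jump_power_nonneg: "0 \<le> jump_power V k n z"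
  by (induction k arbitrary: n z)
    (auto intro!: add_nonneg_nonneg mult_nonneg_nonneg sum_nonneg V_nonneg split: nat.split)

lemma peak_nonneg: "0 \<le> peak V n"
  using peak_ge[of 0 n V] V_nonneg[of 0] by simp

lemma peak_le: "peak V n \<le> C + K * real n"
  unfolding peak_le_iff using V_le K_nonneg
  by (metis add_left_mono mult_left_mono of_nat_mono order_trans)

text \<open>
  The factors count the times at which the jumps occur and their directions, and bound the weight of
  each of the \<open>k - n\<close> pauses by the maximum over the ball that \<open>n\<close> jumps can reach.
\<close>

lemma sum_jump_power_le:
  "(\<Sum>z | l1 z \<le> n. jump_power V k n z)
     \<le> real (k choose n) * (2 * real CARD('n)) ^ n * peak V n ^ (k - n)"
proof (induction k arbitrary: n)
  case 0
  show ?case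
    by (cases "n = 0") (auto simp: l1_eq_0_iff)
next
  case (Suc k)
  let ?D = "2 * real CARD('n)"
  have 1: "(\<Sum>z | l1 z \<le> n. V z * jump_power V k n z)
      \<le> real (k choose n) * ?D ^ n * peak V n ^ (Suc k - n)"
  proof -
    have "(\<Sum>z | l1 z \<le> n. V z * jump_power V k n z)
        \<le> (\<Sum>z | l1 z \<le> n. peak V n * jump_power V k n z)"
      by (intro sum_mono mult_right_mono jump_power_nonneg) (auto intro: peak_ge)
    also have "\<dots> = peak V n * (\<Sum>z | l1 z \<le> n. jump_power V k n z)"
      by (simp add: sum_distrib_left)
    also have "\<dots> \<le> peak V n * (real (k choose n) * ?D ^ n * peak V n ^ (k - n))"
      by (intro mult_left_mono Suc.IH peak_nonneg)
    also have "\<dots> = real (k choose n) * ?D ^ n * peak V n ^ (Suc k - n)"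
      by (cases "n \<le> k") (auto simp: Suc_diff_le)
    finally show ?thesis .
  qed
  show ?case
  proof (cases n)
    case 0
    then show ?thesis using 1 by simp
  next
    case (Suc m)
    have "(\<Sum>z | l1 z \<le> n. \<Sum>y\<in>lattice_neighbours z. jump_power V k m y)
        \<le> ?D * (\<Sum>y | l1 y \<le> m. jump_power V k m y)"
      by (rule sum_neighbours_le) (auto simp: jump_power_nonneg jump_power_support not_le)
    also have "\<dots> \<le> ?D * (real (k choose m) * ?D ^ m * peak V m ^ (k - m))"
      by (intro mult_left_mono Suc.IH) auto
    also have "\<dots> \<le> ?D * (real (k choose m) * ?D ^ m * peak V n ^ (k - m))"
      using Suc by (intro mult_left_mono power_mono peak_mono peak_nonneg) auto
    finally have 2: "(\<Sum>z | l1 z \<le> n. \<Sum>y\<in>lattice_neighbours z. jump_power V k m y)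
        \<le> real (k choose m) * ?D ^ n * peak V n ^ (Suc k - n)"
      using Suc by (simp add: mult_ac)
    have "(\<Sum>z | l1 z \<le> n. jump_power V (Suc k) n z)
        = (\<Sum>z | l1 z \<le> n. V z * jump_power V k n z)
          + (\<Sum>z | l1 z \<le> n. \<Sum>y\<in>lattice_neighbours z. jump_power V k m y)"
      using Suc by (simp add: sum.distrib)
    also have "\<dots> \<le> real (k choose n) * ?D ^ n * peak V n ^ (Suc k - n)
        + real (k choose m) * ?D ^ n * peak V n ^ (Suc k - n)"
      by (intro add_mono 1 2)
    also have "\<dots> = real (Suc k choose n) * ?D ^ n * peak V n ^ (Suc k - n)"
      using Suc by (simp add: algebra_simps)
    finally show ?thesis .
  qed
qed

lemma sum_anderson_power_le:
  assumes "finite F"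
  shows "(\<Sum>z\<in>F. anderson_power V k z)
    \<le> (\<Sum>n\<le>k. real (k choose n) * (2 * real CARD('n)) ^ n * peak V n ^ (k - n))"
proof -
  have "(\<Sum>z\<in>F. anderson_power V k z) = (\<Sum>n\<le>k. \<Sum>z\<in>F. jump_power V k n z)"
    by (simp add: anderson_power_eq_sum_jump_power sum.swap[of _ F])
  also have "\<dots> \<le> (\<Sum>n\<le>k. \<Sum>z | l1 z \<le> n. jump_power V k n z)"
  proof (rule sum_mono)
    fix n
    have "(\<Sum>z\<in>F. jump_power V k n z) = (\<Sum>z\<in>F \<inter> {z. l1 z \<le> n}. jump_power V k n z)"
      using assms by (intro sum.mono_neutral_right) (auto simp: jump_power_support not_le)
    also have "\<dots> \<le> (\<Sum>z | l1 z \<le> n. jump_power V k n z)"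
      by (intro sum_mono2) (auto simp: jump_power_nonneg)
    finally show "(\<Sum>z\<in>F. jump_power V k n z) \<le> (\<Sum>z | l1 z \<le> n. jump_power V k n z)" .
  qed
  also have "\<dots> \<le> (\<Sum>n\<le>k. real (k choose n) * (2 * real CARD('n)) ^ n * peak V n ^ (k - n))"
    by (intro sum_mono sum_jump_power_le)
  finally show ?thesis .
qed

text \<open>
  A bound for the paths with \<open>n\<close> jumps: up to the factor \<open>exp (- 2 d t)\<close> it is the probability that the
  walk jumps \<open>n\<close> times before time \<open>t\<close>, times the largest possible Feynman-Kac weight.
\<close>

definition jump_bound :: "real \<Rightarrow> nat \<Rightarrow> real" where
  "jump_bound t n = (2 * real CARD('n) * t) ^ n / fact n * exp (t * peak V n)"

lemma jump_bound_nonneg: "0 \<le> t \<Longrightarrow> 0 \<le> jump_bound t n"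
  by (simp add: jump_bound_def)

lemma summable_jump_bound:
  assumes "0 \<le> t"
  shows "summable (jump_bound t)"
proof (rule summable_comparison_test')
  let ?x = "2 * real CARD('n) * t * exp (t * K)"
  show "summable (\<lambda>n. exp (t * C) * (?x ^ n / fact n))"
    using summable_exp[of ?x] by (intro summable_mult) (simp add: field_simps)
  fix n :: nat
  have "exp (t * peak V n) \<le> exp (t * (C + K * real n))"
    using peak_le assms by (simp add: mult_left_mono)
  also have "\<dots> = exp (t * C) * exp (t * K) ^ n"
    by (simp add: algebra_simps exp_add flip: exp_of_nat_mult)
  finally have "jump_bound t n \<le> (2 * real CARD('n) * t) ^ n / fact n * (exp (t * C) * exp (t * K) ^ n)"
    unfolding jump_bound_def using assms by (intro mult_left_mono) auto
  then show "norm (jump_bound t n) \<le> exp (t * C) * (?x ^ n / fact n)"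
    using jump_bound_nonneg[OF assms, of n] by (simp add: power_mult_distrib mult_ac)
qed

text \<open>
  With \<open>k = n + j\<close>, the factor \<open>t\<^sup>k / k! \<cdot> (k choose n)\<close> splits as \<open>t\<^sup>n / n! \<cdot> t\<^sup>j / j!\<close>, and the sum over the
  number \<open>j\<close> of pauses is an exponential series. Working with partial sums makes this the source of
  summability as well.
\<close>

lemma sum_series_le_jump_bound:
  assumes "finite F" "0 \<le> t"
  shows "(\<Sum>k<N. (\<Sum>z\<in>F. anderson_power V k z) / fact k * t ^ k) \<le> (\<Sum>n<N. jump_bound t n)"
proof -
  let ?D = "2 * real CARD('n)"
  let ?g = "\<lambda>n j. (?D * t) ^ n / fact n * ((t * peak V n) ^ j / fact j)"
  have g: "0 \<le> ?g n j" for n j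
    using assms peak_nonneg by simp
  have "(\<Sum>k<N. (\<Sum>z\<in>F. anderson_power V k z) / fact k * t ^ k)
      \<le> (\<Sum>k<N. \<Sum>n\<le>k. ?g n (k - n))"
  proof (rule sum_mono)
    fix k
    have "(\<Sum>z\<in>F. anderson_power V k z) / fact k * t ^ k
        \<le> (\<Sum>n\<le>k. real (k choose n) * ?D ^ n * peak V n ^ (k - n)) / fact k * t ^ k"
      using assms by (intro mult_right_mono divide_right_mono sum_anderson_power_le) auto
    also have "\<dots> = (\<Sum>n\<le>k. ?g n (k - n))"
      unfolding sum_divide_distrib sum_distrib_right
    proof (rule sum.cong)
      fix n assume "n \<in> {..k}"
      then have nk: "n \<le> k" by simp
      then have "t ^ k = t ^ n * t ^ (k - n)"
        by (simp flip: power_add)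
      then show "real (k choose n) * ?D ^ n * peak V n ^ (k - n) / fact k * t ^ k = ?g n (k - n)"
        using nk by (simp add: binomial_fact power_mult_distrib field_simps)
    qed simp
    finally show "(\<Sum>z\<in>F. anderson_power V k z) / fact k * t ^ k \<le> (\<Sum>n\<le>k. ?g n (k - n))" .
  qed
  also have "\<dots> = (\<Sum>(n, j)\<in>{(n, j). n + j < N}. ?g n j)"
    by (rule sum.triangle_reindex[symmetric])
  also have "\<dots> \<le> (\<Sum>(n, j)\<in>{..<N} \<times> {..<N}. ?g n j)"
    using g by (intro sum_mono2) auto
  also have "\<dots> = (\<Sum>n<N. (?D * t) ^ n / fact n * (\<Sum>j<N. (t * peak V n) ^ j / fact j))"
    by (simp only: sum.cartesian_product[symmetric] sum_distrib_left)
  also have "\<dots> \<le> (\<Sum>n<N. jump_bound t n)"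
    unfolding jump_bound_def using assms peak_nonneg
    by (intro sum_mono mult_left_mono sum_exp_series_le) auto
  finally show ?thesis .
qed

lemma summable_sum_series:
  assumes "finite F"
  shows "summable (\<lambda>k. (\<Sum>z\<in>F. anderson_power V k z) / fact k * t ^ k)"
proof (rule summable_norm_cancel, rule summableI_nonneg_bounded)
  fix N :: nat
  have "(\<Sum>k<N. norm ((\<Sum>z\<in>F. anderson_power V k z) / fact k * t ^ k))
      = (\<Sum>k<N. (\<Sum>z\<in>F. anderson_power V k z) / fact k * \<bar>t\<bar> ^ k)"
    by (intro sum.cong) (auto simp: abs_mult power_abs sum_nonneg anderson_power_nonneg)
  also have "\<dots> \<le> (\<Sum>n<N. jump_bound \<bar>t\<bar> n)"
    using assms by (intro sum_series_le_jump_bound) auto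
  also have "\<dots> \<le> (\<Sum>n. jump_bound \<bar>t\<bar> n)"
    by (intro sum_le_suminf summable_jump_bound) (auto simp: jump_bound_nonneg)
  finally show "(\<Sum>k<N. norm ((\<Sum>z\<in>F. anderson_power V k z) / fact k * t ^ k))
    \<le> (\<Sum>n. jump_bound \<bar>t\<bar> n)" .
qed simp

lemma summable_series: "summable (\<lambda>k. anderson_power V k z / fact k * t ^ k)"
  using summable_sum_series[of "{z}" t] by simp

definition anderson_series :: "real \<Rightarrow> int ^ 'n \<Rightarrow> real" where
  "anderson_series t z = exp (- (2 * real CARD('n)) * t) * (\<Sum>k. anderson_power V k z / fact k * t ^ k)"

text \<open>
  The value \<open>0\<close> for negative times is the convention of \<open>pam_solution\<close>.
\<close>

definition pam_series :: "real \<Rightarrow> int ^ 'n \<Rightarrow> real" where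
  "pam_series t z = (if t < 0 then 0 else anderson_series t z)"

lemma anderson_series_nonneg: "0 \<le> t \<Longrightarrow> 0 \<le> anderson_series t z"
  unfolding anderson_series_def by (intro mult_nonneg_nonneg suminf_nonneg summable_series) (auto simp: anderson_power_nonneg)

lemma anderson_series_has_derivative:
  "((\<lambda>s. anderson_series s z) has_real_derivative (discrete_laplacian (anderson_series t) z + V z * anderson_series t z)) (at t)"
proof -
  let ?D = "2 * real CARD('n)"
  let ?S = "\<lambda>z t. \<Sum>k. anderson_power V k z / fact k * t ^ k"
  have d: "(?S z has_real_derivative (\<Sum>k. diffs (\<lambda>k. anderson_power V k z / fact k) k * t ^ k)) (at t)"
    by (rule termdiffs_strong_converges_everywhere) (rule summable_series)
  have "diffs (\<lambda>k. anderson_power V k z / fact k) k * t ^ k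
      = V z * (anderson_power V k z / fact k * t ^ k)
        + (\<Sum>y\<in>lattice_neighbours z. anderson_power V k y / fact k * t ^ k)" for k
  proof -
    have "diffs (\<lambda>k. anderson_power V k z / fact k) k = anderson_power V (Suc k) z / fact k"
      by (simp add: diffs_def del: anderson_power.simps of_nat_Suc)
    then show ?thesis
      by (simp add: add_divide_distrib distrib_right sum_distrib_right sum_divide_distrib)
  qed
  then have e: "(\<Sum>k. diffs (\<lambda>k. anderson_power V k z / fact k) k * t ^ k)
      = V z * ?S z t + (\<Sum>y\<in>lattice_neighbours z. ?S y t)"
    by (simp only: suminf_add[OF summable_mult summable_sum, symmetric] suminf_mult suminf_sum summable_series)
  have "(\<Sum>y\<in>lattice_neighbours z. anderson_series t y - anderson_series t z)
      = (\<Sum>y\<in>lattice_neighbours z. anderson_series t y) - ?D * anderson_series t z"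
    by (simp add: sum_subtractf card_lattice_neighbours)
  then have l: "discrete_laplacian (anderson_series t) z + V z * anderson_series t z
      = exp (- ?D * t) * (V z * ?S z t + (\<Sum>y\<in>lattice_neighbours z. ?S y t)) + exp (- ?D * t) * (- ?D) * ?S z t"
    by (simp add: discrete_laplacian_def anderson_series_def sum_distrib_left algebra_simps)
  show ?thesis
    unfolding l unfolding anderson_series_def
    by (rule derivative_eq_intros refl d)+ (simp add: e)
qed

lemma pam_solution_pam_series: "pam_solution V pam_series"
  unfolding pam_solution_def
proof (intro conjI allI impI)
  fix t :: real and z :: "int ^ 'n" assume t: "0 < t"
  have "((\<lambda>s. anderson_series s z) has_real_derivative
      (discrete_laplacian (pam_series t) z + V z * pam_series t z)) (at t)"
    using anderson_series_has_derivative[of z t] t by (simp add: pam_series_def discrete_laplacian_def)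
  then show "((\<lambda>s. pam_series s z) has_real_derivative
      (discrete_laplacian (pam_series t) z + V z * pam_series t z)) (at t)"
    by (rule has_field_derivative_transform_within_open[where S = "{0<..}"])
      (use t in \<open>auto simp: pam_series_def\<close>)
next
  fix z :: "int ^ 'n"
  show "pam_series 0 z = indicator {0} z"
    using powser_zero[of "\<lambda>k. anderson_power V k z / fact k"] by (simp add: pam_series_def anderson_series_def)
next
  fix z :: "int ^ 'n"
  have "continuous_on {0..} (\<lambda>t. anderson_series t z)"
    by (rule DERIV_continuous_on[OF has_field_derivative_at_within[OF anderson_series_has_derivative]])
  then show "continuous_on {0..} (\<lambda>t. pam_series t z)"
    by (rule continuous_on_cong[THEN iffD1, rotated -1]) (auto simp: pam_series_def)
qed (auto simp: pam_series_def anderson_series_nonneg)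


end

section \<open>Uniqueness of nonnegative solutions\<close>

text \<open>
  By the integrating factor \<open>exp (- c s)\<close>, a function with \<open>F' \<ge> c F\<close> that starts nonnegative stays so.
  The estimates for solutions below reduce to this one-dimensional principle by looking at one site at a time.
\<close>

lemma linear_comparison:
  fixes F F' :: "real \<Rightarrow> real"
  assumes "0 \<le> T" and cont: "continuous_on {0..T} F"
    and deriv: "\<And>s. 0 < s \<Longrightarrow> s < T \<Longrightarrow> (F has_real_derivative F' s) (at s)"
    and ineq: "\<And>s. 0 < s \<Longrightarrow> s < T \<Longrightarrow> c * F s \<le> F' s"
    and init: "0 \<le> F 0"
  shows "0 \<le> F T"
proof -
  let ?G = "\<lambda>s. exp (- c * s) * F s"
  have "?G 0 \<le> ?G T"
  proof (rule DERIV_nonneg_imp_increasing_open[where f = ?G])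
    fix s assume s: "0 < s" "s < T"
    have "(?G has_real_derivative exp (- c * s) * (F' s - c * F s)) (at s)"
      by (rule derivative_eq_intros refl deriv[OF s])+ (simp add: algebra_simps)
    then show "\<exists>y. (?G has_real_derivative y) (at s) \<and> 0 \<le> y"
      using ineq[OF s] by (intro exI[of _ "exp (- c * s) * (F' s - c * F s)"]) auto
  qed (use assms in \<open>auto intro!: continuous_intros\<close>)
  then have "0 \<le> exp (- c * T) * F T"
    using init by simp
  then show ?thesis
    by (simp add: zero_le_mult_iff del: mult_minus_left)
qed

lemma pam_solutionD:
  assumes "pam_solution V u"
  shows "0 < t \<Longrightarrow> ((\<lambda>s. u s z) has_real_derivative (discrete_laplacian (u t) z + V z * u t z)) (at t)"
    and "u 0 z = indicator {0} z"
    and "continuous_on {0..} (\<lambda>t. u t z)"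
    and "0 \<le> t \<Longrightarrow> 0 \<le> u t z"
    and "t < 0 \<Longrightarrow> u t z = 0"
  using assms unfolding pam_solution_def by auto

lemma discrete_laplacian_eq:
  "discrete_laplacian f (z :: int ^ 'n) = (\<Sum>y\<in>lattice_neighbours z. f y) - (2 * real CARD('n)) * f z"
  by (simp add: discrete_laplacian_def sum_subtractf card_lattice_neighbours)

lemma exp_power_fact_has_derivative:
  "((\<lambda>s. exp (c * s) * (x * s) ^ Suc k / fact (Suc k)) has_real_derivative
      (c * (exp (c * s) * (x * s) ^ Suc k / fact (Suc k)) + x * (exp (c * s) * (x * s) ^ k / fact k))) (at s)"
proof -
  have "((\<lambda>s. (x * s) ^ Suc k) has_real_derivative (1 + real k) * (x * (x * s) ^ k)) (at s)"
    by (rule DERIV_power_Suc) (auto intro!: derivative_eq_intros)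
  moreover have "((\<lambda>s. exp (c * s)) has_real_derivative exp (c * s) * c) (at s)"
    by (auto intro!: derivative_eq_intros)
  ultimately have "((\<lambda>s. exp (c * s) * (x * s) ^ Suc k / fact (Suc k)) has_real_derivative
      (exp (c * s) * c * (x * s) ^ Suc k + (1 + real k) * (x * (x * s) ^ k) * exp (c * s)) / fact (Suc k)) (at s)"
    by (intro DERIV_cdivide DERIV_mult)
  moreover have "(exp (c * s) * c * (x * s) ^ Suc k + (1 + real k) * (x * (x * s) ^ k) * exp (c * s)) / fact (Suc k)
     = c * (exp (c * s) * (x * s) ^ Suc k / fact (Suc k)) + x * (exp (c * s) * (x * s) ^ k / fact k)"
  proof -
    have "fact (Suc k) = (1 + real k) * fact k" "(1 + real k) \<noteq> 0"
      by (auto simp: add_nonneg_eq_0_iff)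
    then show ?thesis
      by (simp add: add_divide_distrib mult_ac del: fact_Suc power_Suc)
  qed
  ultimately show ?thesis by simp
qed

text \<open>
  Mass present at \<open>z\<close> flows to \<open>y\<close>: the factor is the probability that the walk makes the jumps of a
  fixed shortest path, and nothing else, during time \<open>\<tau>\<close>; a nonnegative potential can only increase the
  flow. The induction on the distance compares the solution at \<open>y\<close> with the inflow from the previous site
  of that path.
\<close>

lemma pam_solution_harnack:
  fixes V :: "int ^ 'n \<Rightarrow> real"
  assumes u: "pam_solution V u" and V: "\<And>z. 0 \<le> V z" and "0 \<le> s" "0 \<le> \<tau>"
  shows "exp (- (2 * real CARD('n)) * \<tau>) * \<tau> ^ l1 (y - z) / fact (l1 (y - z)) * u s z \<le> u (s + \<tau>) y"
  using \<open>0 \<le> \<tau>\<close>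
proof (induction "l1 (y - z)" arbitrary: y \<tau>)
  case 0
  let ?d = "2 * real CARD('n)"
  have y: "y = z" using 0 l1_eq_0_iff[of "y - z"] by simp
  have "0 \<le> u (s + \<tau>) y - exp (- ?d * \<tau>) * u s y"
  proof (rule linear_comparison[where c = "- ?d" and T = \<tau>
        and F = "\<lambda>\<tau>. u (s + \<tau>) y - exp (- ?d * \<tau>) * u s y"])
    show "continuous_on {0..\<tau>} (\<lambda>\<tau>. u (s + \<tau>) y - exp (- ?d * \<tau>) * u s y)"
      using \<open>0 \<le> s\<close> by (intro continuous_intros continuous_on_compose2[OF pam_solutionD(3)[OF u]]) auto
    fix r assume r: "0 < r" "r < \<tau>"
    have "((\<lambda>\<tau>. u (s + \<tau>) y) has_real_derivative
        (discrete_laplacian (u (s + r)) y + V y * u (s + r) y) * (0 + 1)) (at r)"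
      using r \<open>0 \<le> s\<close>
      by (intro DERIV_chain2[where f = "\<lambda>t. u t y"] pam_solutionD(1)[OF u]) (auto intro!: derivative_eq_intros)
    then show "((\<lambda>\<tau>. u (s + \<tau>) y - exp (- ?d * \<tau>) * u s y) has_real_derivative
       discrete_laplacian (u (s + r)) y + V y * u (s + r) y + ?d * exp (- ?d * r) * u s y) (at r)"
      by (auto intro!: derivative_eq_intros)
    have "0 \<le> (\<Sum>x\<in>lattice_neighbours y. u (s + r) x)" "0 \<le> V y * u (s + r) y"
      using r \<open>0 \<le> s\<close> V by (auto intro!: sum_nonneg pam_solutionD(4)[OF u] mult_nonneg_nonneg)
    then show "- ?d * (u (s + r) y - exp (- ?d * r) * u s y)
      \<le> discrete_laplacian (u (s + r)) y + V y * u (s + r) y + ?d * exp (- ?d * r) * u s y"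
      by (simp add: discrete_laplacian_eq algebra_simps)
  qed (use 0 in auto)
  then show ?case using y by simp
next
  case (Suc k)
  let ?d = "2 * real CARD('n)"
  obtain x where x: "x \<in> lattice_neighbours y" "l1 (x - z) = k"
    using neighbour_towards Suc.hyps(2)[symmetric] by blast
  let ?e = "\<lambda>k \<tau>. exp (- ?d * \<tau>) * (1 * \<tau>) ^ k / fact k"
  have "0 \<le> u (s + \<tau>) y - ?e (Suc k) \<tau> * u s z"
  proof (rule linear_comparison[where c = "- ?d" and T = \<tau>
        and F = "\<lambda>\<tau>. u (s + \<tau>) y - ?e (Suc k) \<tau> * u s z"])
    show "continuous_on {0..\<tau>} (\<lambda>\<tau>. u (s + \<tau>) y - ?e (Suc k) \<tau> * u s z)"
      using \<open>0 \<le> s\<close>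
      by (intro continuous_intros continuous_on_compose2[OF pam_solutionD(3)[OF u]]) auto
    fix r assume r: "0 < r" "r < \<tau>"
    have "((\<lambda>\<tau>. u (s + \<tau>) y) has_real_derivative
        (discrete_laplacian (u (s + r)) y + V y * u (s + r) y) * (0 + 1)) (at r)"
      using r \<open>0 \<le> s\<close>
      by (intro DERIV_chain2[where f = "\<lambda>t. u t y"] pam_solutionD(1)[OF u]) (auto intro!: derivative_eq_intros)
    then show "((\<lambda>\<tau>. u (s + \<tau>) y - ?e (Suc k) \<tau> * u s z) has_real_derivative
       (discrete_laplacian (u (s + r)) y + V y * u (s + r) y) * (0 + 1)
       - (- ?d * ?e (Suc k) r + 1 * ?e k r) * u s z) (at r)"
      by (rule DERIV_diff) (rule DERIV_cmult_right[OF exp_power_fact_has_derivative])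
    have "u (s + r) x \<le> (\<Sum>x\<in>lattice_neighbours y. u (s + r) x)"
      using x r \<open>0 \<le> s\<close> by (intro member_le_sum pam_solutionD(4)[OF u]) auto
    moreover have "?e k r * u s z \<le> u (s + r) x"
      using Suc.hyps(1)[of x r] x r by simp
    moreover have "0 \<le> V y * u (s + r) y"
      using r \<open>0 \<le> s\<close> V by (auto intro!: pam_solutionD(4)[OF u] mult_nonneg_nonneg)
    ultimately have "?e k r * u s z \<le> (\<Sum>x\<in>lattice_neighbours y. u (s + r) x) + V y * u (s + r) y"
      by linarith
    then show "- ?d * (u (s + r) y - ?e (Suc k) r * u s z)
      \<le> (discrete_laplacian (u (s + r)) y + V y * u (s + r) y) * (0 + 1)
       - (- ?d * ?e (Suc k) r + 1 * ?e k r) * u s z"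
      unfolding discrete_laplacian_eq left_diff_distrib right_diff_distrib distrib_right by simp
  next
    show "0 \<le> u (s + 0) y - ?e (Suc k) 0 * u s z"
      using \<open>0 \<le> s\<close> pam_solutionD(4)[OF u] by simp
  qed (use Suc.prems in auto)
  then show ?case using Suc.hyps(2)[symmetric] by simp
qed

text \<open>
  The difference of two solutions vanishes at time \<open>0\<close>, so within the ball of radius \<open>n\<close> it can only
  enter through the boundary. Reaching a site at distance \<open>j\<close> from the boundary takes \<open>j\<close> jumps, and
  each induction step gains the factor \<open>2 d s / j\<close> by integrating over the time of one jump.
\<close>

lemma pam_difference_bound:
  fixes V :: "int ^ 'n \<Rightarrow> real"
  assumes u: "pam_solution V u" and v: "pam_solution V v"
    and V: "\<And>y. l1 (y - c) \<le> n \<Longrightarrow> 0 \<le> V y \<and> V y \<le> M" and "0 \<le> B"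
    and bd: "\<And>s y. 0 \<le> s \<Longrightarrow> s \<le> t \<Longrightarrow> l1 (y - c) \<le> n \<Longrightarrow> \<bar>u s y - v s y\<bar> \<le> B"
  shows "0 \<le> s \<Longrightarrow> s \<le> t \<Longrightarrow> l1 (y - c) + j \<le> n \<Longrightarrow>
    \<bar>u s y - v s y\<bar> \<le> exp (M * s) * (2 * real CARD('n) * s) ^ j / fact j * B"
proof (induction j arbitrary: s y)
  case 0
  have "0 \<le> M" using V[of y] 0 by simp
  then have "B \<le> exp (M * s) * B"
    using \<open>0 \<le> B\<close> 0 by (simp add: mult_le_cancel_right1)
  then show ?case using bd[of s y] 0 by simp
next
  case (Suc j)
  let ?d = "2 * real CARD('n)"
  let ?e = "\<lambda>k s. exp (M * s) * (?d * s) ^ k / fact k"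
  have y: "0 \<le> V y" "V y \<le> M" using V[of y] Suc.prems by auto
  have key: "0 \<le> ?e (Suc j) s * B - \<sigma> * (u s y - v s y)" if \<sigma>: "\<sigma> = 1 \<or> \<sigma> = -1" for \<sigma>
  proof (rule linear_comparison[where c = "V y - ?d" and T = s
        and F = "\<lambda>s. ?e (Suc j) s * B - \<sigma> * (u s y - v s y)"])
    show "continuous_on {0..s} (\<lambda>s. ?e (Suc j) s * B - \<sigma> * (u s y - v s y))"
      by (intro continuous_intros continuous_on_subset[OF pam_solutionD(3)[OF u]]
          continuous_on_subset[OF pam_solutionD(3)[OF v]]) auto
    fix r assume r: "0 < r" "r < s"
    let ?D = "\<lambda>y. u r y - v r y"
    let ?S = "\<Sum>x\<in>lattice_neighbours y. ?D x"
    have "((\<lambda>s. u s y - v s y) has_real_derivative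
       (discrete_laplacian (u r) y + V y * u r y) - (discrete_laplacian (v r) y + V y * v r y)) (at r)"
      by (intro DERIV_diff pam_solutionD(1)[OF u] pam_solutionD(1)[OF v] r)
    also have "(discrete_laplacian (u r) y + V y * u r y) - (discrete_laplacian (v r) y + V y * v r y)
       = ?S + (V y - ?d) * ?D y"
      by (simp add: discrete_laplacian_eq sum_subtractf algebra_simps)
    finally show "((\<lambda>s. ?e (Suc j) s * B - \<sigma> * (u s y - v s y)) has_real_derivative
       (M * ?e (Suc j) r + ?d * ?e j r) * B - \<sigma> * (?S + (V y - ?d) * ?D y)) (at r)"
      by (intro DERIV_diff DERIV_cmult DERIV_cmult_right[OF exp_power_fact_has_derivative])
    have "\<bar>\<sigma> * ?S\<bar> = \<bar>?S\<bar>"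
      using \<sigma> by auto
    also have "\<dots> \<le> (\<Sum>x\<in>lattice_neighbours y. \<bar>?D x\<bar>)"
      by (rule sum_abs)
    also have "\<dots> \<le> (\<Sum>x\<in>lattice_neighbours y. ?e j r * B)"
    proof (rule sum_mono)
      fix x assume "x \<in> lattice_neighbours y"
      then show "\<bar>?D x\<bar> \<le> ?e j r * B"
        using Suc.prems r l1_neighbour_le[of x y c] by (intro Suc.IH) auto
    qed
    also have "\<dots> = ?d * (?e j r * B)"
      by (simp add: card_lattice_neighbours)
    finally have 1: "\<sigma> * ?S \<le> ?d * (?e j r * B)" by linarith
    have 2: "(V y - ?d) * (?e (Suc j) r * B) \<le> M * (?e (Suc j) r * B)"
      using y r \<open>0 \<le> B\<close> by (intro mult_right_mono mult_nonneg_nonneg) auto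
    show "(V y - ?d) * (?e (Suc j) r * B - \<sigma> * (u r y - v r y))
       \<le> (M * ?e (Suc j) r + ?d * ?e j r) * B - \<sigma> * (?S + (V y - ?d) * ?D y)"
      using add_mono[OF 1 2] by (simp only: algebra_simps)
  qed (use Suc.prems in \<open>auto simp: pam_solutionD(2)[OF u] pam_solutionD(2)[OF v]\<close>)
  show ?case using key[of 1] key[of "-1"] by (simp add: abs_le_iff)
qed

text \<open>
  The Harnack bound at distance \<open>k\<close> has the factor \<open>k! / \<tau>\<^sup>k\<close>, which is not monotone in \<open>k\<close>. Up to the
  constant \<open>exp \<tau>\<close> it is, because \<open>\<tau>\<^sup>j / j! \<le> exp \<tau>\<close> for \<open>j = n - k\<close>; so a whole ball can be bounded by
  the value at its radius.
\<close>

lemma fact_over_power_le: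
  assumes "1 \<le> (\<tau> :: real)" "k \<le> n"
  shows "fact k / \<tau> ^ k \<le> exp \<tau> * (fact n / \<tau> ^ n)"
proof -
  have "\<tau> ^ (n - k) / fact (n - k) \<le> exp \<tau>"
    using sum_exp_series_le[of \<tau> "Suc (n - k)"] member_le_sum[of "n - k" "{..<Suc (n - k)}" "\<lambda>j. \<tau> ^ j / fact j"] assms
    by auto
  then have 1: "\<tau> ^ (n - k) \<le> exp \<tau> * fact (n - k)"
    by (simp add: field_simps)
  have "fact k * fact (n - k) \<le> (fact n :: real)"
  proof -
    have "1 \<le> real (n choose k)"
      using assms by (simp add: Suc_le_eq)
    then have "1 \<le> fact n / (fact k * fact (n - k) :: real)"
      using assms by (simp add: binomial_fact)
    then show ?thesis by (simp add: field_simps)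
  qed
  then have 2: "exp \<tau> * (fact k * fact (n - k)) \<le> exp \<tau> * fact n"
    by (intro mult_left_mono) auto
  have "fact k * \<tau> ^ (n - k) \<le> fact k * (exp \<tau> * fact (n - k))"
    using 1 by (intro mult_left_mono) auto
  also have "\<dots> = exp \<tau> * (fact k * fact (n - k))"
    by (rule mult.left_commute)
  also note 2
  finally have "fact k * \<tau> ^ (n - k) \<le> exp \<tau> * fact n" .
  moreover have "\<tau> ^ n = \<tau> ^ k * \<tau> ^ (n - k)"
    using assms by (simp flip: power_add)
  ultimately show ?thesis
    using assms by (simp add: divide_simps mult_ac)
qed

context linear_potential
begin

text \<open>
  The Harnack inequality read backwards: all values in the ball up to time \<open>t\<close> are controlled by the
  single number \<open>u (t + \<tau>) c\<close>. Solutions are global in time, so \<open>\<tau>\<close> may be chosen as large as desired.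
\<close>

lemma pam_solution_le_at_centre:
  assumes u: "pam_solution V u" and "0 \<le> s" "s \<le> t" "1 \<le> \<tau>" "l1 (y - c) \<le> n"
  shows "u s y \<le> u (t + \<tau>) c * exp (2 * real CARD('n) * (t + \<tau>)) * exp \<tau> * (fact n / \<tau> ^ n)"
proof -
  let ?d = "2 * real CARD('n)" and ?k = "l1 (c - y)"
  let ?r = "t + \<tau> - s"
  have k: "?k \<le> n" using assms l1_minus[of "y - c"] by simp
  have r: "\<tau> \<le> ?r" "0 < ?r" using assms by auto
  have "exp (- ?d * ?r) * ?r ^ ?k / fact ?k * u s y \<le> u (s + ?r) c"
    using assms by (intro pam_solution_harnack[OF u] V_nonneg) auto
  then have h: "exp (- ?d * ?r) * ?r ^ ?k / fact ?k * u s y \<le> u (t + \<tau>) c" by simp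
  have un: "0 \<le> u s y" "0 \<le> u (t + \<tau>) c" using assms by (auto intro!: pam_solutionD(4)[OF u])
  have "u s y = (exp (- ?d * ?r) * ?r ^ ?k / fact ?k * u s y) * exp (?d * ?r) * (fact ?k / ?r ^ ?k)"
    using r by (simp add: exp_minus)
  also have "\<dots> \<le> u (t + \<tau>) c * exp (?d * (t + \<tau>)) * (fact ?k / \<tau> ^ ?k)"
    using assms r un h
    by (intro mult_mono divide_left_mono power_mono mult_nonneg_nonneg) (auto intro!: mult_left_mono)
  also have "\<dots> \<le> u (t + \<tau>) c * exp (?d * (t + \<tau>)) * (exp \<tau> * (fact n / \<tau> ^ n))"
    using assms k un by (intro mult_left_mono fact_over_power_le) auto
  finally show ?thesis by (simp add: mult_ac)
qed

text \<open>
  Inserting the Harnack bound of order \<open>n! / \<tau>\<^sup>n\<close> as boundary value into \<open>pam_difference_bound\<close> cancels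
  the \<open>n!\<close>, and leaves \<open>(2 d t exp (K t) / \<tau>)\<^sup>n\<close> up to a constant. The choice of \<open>\<tau>\<close> makes the base at
  most \<open>1/2\<close>, and \<open>n\<close> tends to infinity.
\<close>

lemma pam_solution_unique_at:
  assumes u: "pam_solution V u" and v: "pam_solution V v" and t: "0 < t"
  shows "u t c = v t c"
proof -
  let ?d = "2 * real CARD('n)"
  define \<tau> where "\<tau> = 1 + 2 * (?d * t * exp (K * t))"
  have tau: "1 \<le> \<tau>" using t by (simp add: \<tau>_def)
  define A where "A = max (u (t + \<tau>) c) (v (t + \<tau>) c) * exp (?d * (t + \<tau>)) * exp \<tau>"
  have A: "0 \<le> A"
    using t tau unfolding A_def by (intro mult_nonneg_nonneg) (auto simp: le_max_iff_disj intro!: pam_solutionD(4)[OF u])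
  define A' where "A' = A * exp (\<bar>C\<bar> * t + K * real (l1 c) * t)"
  have bound: "\<bar>u t c - v t c\<bar> \<le> A' * (1 / 2) ^ n" for n
  proof -
    define M where "M = \<bar>C\<bar> + K * (real n + real (l1 c))"
    have "\<bar>u t c - v t c\<bar> \<le> exp (M * t) * (?d * t) ^ n / fact n * (A * (fact n / \<tau> ^ n))"
    proof (rule pam_difference_bound[OF u v, where c = c and n = n and t = t])
      fix y :: "int ^ 'n" assume "l1 (y - c) \<le> n"
      then have "l1 y \<le> n + l1 c"
        using l1_triangle[of "y - c" c] by simp
      then have "real (l1 y) \<le> real n + real (l1 c)" by linarith
      then have "C + K * real (l1 y) \<le> M"
        unfolding M_def using K_nonneg by (intro add_mono mult_left_mono) auto
      then show "0 \<le> V y \<and> V y \<le> M"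
        using V_nonneg[of y] V_le[of y] by linarith
    next
      fix s and y :: "int ^ 'n" assume s: "0 \<le> s" "s \<le> t" "l1 (y - c) \<le> n"
      have le: "w s y \<le> A * (fact n / \<tau> ^ n)" if w: "pam_solution V w" "w = u \<or> w = v" for w
      proof -
        have "w s y \<le> w (t + \<tau>) c * exp (?d * (t + \<tau>)) * exp \<tau> * (fact n / \<tau> ^ n)"
          by (rule pam_solution_le_at_centre[OF w(1) s(1,2) tau s(3)])
        also have "\<dots> \<le> A * (fact n / \<tau> ^ n)"
          unfolding A_def using tau w(2) by (intro mult_right_mono) auto
        finally show ?thesis .
      qed
      have "0 \<le> u s y" "0 \<le> v s y"
        using s pam_solutionD(4)[OF u] pam_solutionD(4)[OF v] by auto
      then show "\<bar>u s y - v s y\<bar> \<le> A * (fact n / \<tau> ^ n)"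
        using le[OF u] le[OF v] by auto
    qed (use A t tau in auto)
    also have "\<dots> = A' * (?d * t * exp (K * t) / \<tau>) ^ n"
    proof -
      have "exp (M * t) = exp (\<bar>C\<bar> * t + K * real (l1 c) * t) * exp (K * t) ^ n"
        by (simp add: M_def algebra_simps flip: exp_of_nat_mult exp_add)
      then show ?thesis
        by (simp add: A'_def power_divide power_mult_distrib)
    qed
    also have "\<dots> \<le> A' * (1 / 2) ^ n"
    proof (intro mult_left_mono power_mono)
      show "?d * t * exp (K * t) / \<tau> \<le> 1 / 2" "0 \<le> ?d * t * exp (K * t) / \<tau>"
        using t tau by (auto simp: pos_divide_le_eq) (simp add: \<tau>_def)
      show "0 \<le> A'" using A by (simp add: A'_def)
    qed
    finally show ?thesis .
  qed
  have "(\<lambda>n. A' * (1 / 2) ^ n) \<longlonglongrightarrow> A' * 0"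
    by (intro tendsto_intros LIMSEQ_power_zero) auto
  then have "\<bar>u t c - v t c\<bar> \<le> A' * 0"
    by (rule Lim_bounded2[where N = 0]) (use bound in auto)
  then show ?thesis by simp
qed

lemma pam_eq: "pam V = pam_series"
  unfolding pam_def
proof (rule the_equality)
  show "pam_solution V pam_series" by (rule pam_solution_pam_series)
next
  fix u assume u: "pam_solution V u"
  show "u = pam_series"
  proof (intro ext)
    fix t :: real and z :: "int ^ 'n"
    consider "t < 0" | "t = 0" | "0 < t" using less_linear[of t 0] by auto
    then show "u t z = pam_series t z"
      by cases
        (auto simp: pam_solutionD(2,5)[OF u] pam_solutionD(2,5)[OF pam_solution_pam_series]
          pam_solution_unique_at[OF u pam_solution_pam_series])
  qed
qed

section \<open>Bounds on the total mass\<close>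

lemma
  assumes t: "0 \<le> t"
  shows pam_summable: "pam V t summable_on UNIV"
    and pam_total_mass_le: "pam_total_mass V t \<le> exp (- (2 * real CARD('n)) * t) * (\<Sum>n. jump_bound t n)"
proof -
  let ?B = "exp (- (2 * real CARD('n)) * t) * (\<Sum>n. jump_bound t n)"
  have fin: "(\<Sum>z\<in>F. pam V t z) \<le> ?B" if "finite F" for F
  proof -
    have "(\<Sum>z\<in>F. pam V t z)
        = exp (- (2 * real CARD('n)) * t) * (\<Sum>k. (\<Sum>z\<in>F. anderson_power V k z) / fact k * t ^ k)"
      using t suminf_sum[of F "\<lambda>z k. anderson_power V k z / fact k * t ^ k", OF summable_series]
      by (simp add: pam_eq pam_series_def anderson_series_def sum_distrib_left[symmetric]
          sum_distrib_right sum_divide_distrib)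
    also have "\<dots> \<le> ?B"
    proof (intro mult_left_mono suminf_le_const summable_sum_series that)
      fix N
      have "(\<Sum>k<N. (\<Sum>z\<in>F. anderson_power V k z) / fact k * t ^ k) \<le> (\<Sum>n<N. jump_bound t n)"
        by (rule sum_series_le_jump_bound[OF that t])
      also have "\<dots> \<le> (\<Sum>n. jump_bound t n)"
        by (intro sum_le_suminf summable_jump_bound t) (auto simp: jump_bound_nonneg t)
      finally show "(\<Sum>k<N. (\<Sum>z\<in>F. anderson_power V k z) / fact k * t ^ k) \<le> (\<Sum>n. jump_bound t n)" .
    qed simp
    finally show ?thesis .
  qed
  have nn: "0 \<le> pam V t z" for z
    using t by (simp add: pam_eq pam_series_def anderson_series_nonneg)
  show s: "pam V t summable_on UNIV"
    by (rule nonneg_bdd_above_summable_on) (auto simp: nn intro!: bdd_aboveI2[where M = ?B] fin)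
  show "pam_total_mass V t \<le> ?B"
    unfolding pam_total_mass_def by (rule infsum_le_finite_sums[OF s]) (rule fin)
qed

lemma pam_le_total_mass:
  assumes "0 \<le> t"
  shows "pam V t z \<le> pam_total_mass V t"
proof -
  have "pam V t z = infsum (pam V t) {z}"
    by simp
  also have "\<dots> \<le> pam_total_mass V t"
    unfolding pam_total_mass_def using assms
    by (intro infsum_mono_neutral pam_summable) (auto simp: pam_eq pam_series_def anderson_series_nonneg)
  finally show ?thesis .
qed

lemma anderson_power_ge_1: "1 \<le> anderson_power V (l1 z) z"
proof (induction "l1 z" arbitrary: z)
  case 0
  then show ?case using l1_eq_0_iff[of z] by simp
next
  case (Suc k)
  obtain y where y: "y \<in> lattice_neighbours z" "l1 y = k"
    using neighbour_towards[of z 0 k] Suc.hyps(2) by auto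
  have "1 \<le> anderson_power V k y"
    using Suc.hyps(1)[of y] y by simp
  also have "\<dots> \<le> (\<Sum>y\<in>lattice_neighbours z. anderson_power V k y)"
    using y by (intro member_le_sum) (auto simp: anderson_power_nonneg)
  also have "\<dots> \<le> anderson_power V (Suc k) z"
    by (simp add: V_nonneg anderson_power_nonneg)
  finally show ?case using Suc.hyps(2) by simp
qed

lemma anderson_power_ge_power:
  assumes "m \<le> V z" "0 \<le> m"
  shows "m ^ j \<le> anderson_power V (l1 z + j) z"
proof (induction j)
  case 0
  then show ?case using anderson_power_ge_1 by simp
next
  case (Suc j)
  have "m ^ Suc j \<le> V z * anderson_power V (l1 z + j) z"
    using Suc assms V_nonneg[of z] by (auto intro!: mult_mono)
  also have "\<dots> \<le> anderson_power V (l1 z + Suc j) z"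
    by (simp add: anderson_power_nonneg sum_nonneg)
  finally show ?case .
qed

text \<open>
  Only paths that go straight to \<open>z\<close> in \<open>n = \<bar>z\<bar>\<close> steps and then pause there are kept. Their weights
  \<open>m\<^sup>k\<^sup>-\<^sup>n\<close> sum to \<open>m\<^sup>-\<^sup>n\<close> times the tail \<open>k \<ge> n\<close> of the exponential series of \<open>t m\<close>. That tail is
  at least half of \<open>exp (t m)\<close> when \<open>t m\<close> is large compared with \<open>n\<close>.
\<close>

lemma pam_total_mass_ge:
  assumes t: "0 < t" and m: "1 \<le> m" "m \<le> V z" and large: "2 * (real (l1 z) + 1) \<le> t * m"
  shows "exp (t * m - 2 * real CARD('n) * t - real (l1 z) * ln m) / 2 \<le> pam_total_mass V t"
proof -
  define n where "n = l1 z"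
  let ?f = "\<lambda>x k. x ^ k / fact k :: real"
  \<comment> \<open>For \<open>k < n\<close> the bracket is nonpositive, since \<open>(t m)\<^sup>k \<le> 2\<^sup>n (t m / 2)\<^sup>k\<close>; so the subtracted series cuts off the head.\<close>
  have termle: "((t * m) ^ k / fact k - 2 ^ n * ((t * m / 2) ^ k / fact k)) / m ^ n
      \<le> anderson_power V k z / fact k * t ^ k" for k
  proof (cases "n \<le> k")
    case True
    have "((t * m) ^ k / fact k - 2 ^ n * ((t * m / 2) ^ k / fact k)) / m ^ n \<le> (t * m) ^ k / fact k / m ^ n"
      using t m by (intro divide_right_mono) auto
    also have "\<dots> = m ^ (k - n) / fact k * t ^ k"
      using True m by (simp add: power_mult_distrib power_diff mult_ac)
    also have "\<dots> \<le> anderson_power V k z / fact k * t ^ k"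
      using anderson_power_ge_power[of m z "k - n"] True m t
      by (intro mult_right_mono divide_right_mono) (auto simp: n_def)
    finally show ?thesis .
  next
    case False
    have "(2::real) ^ k \<le> 2 ^ n" using False by (intro power_increasing) auto
    then have "(t * m) ^ k / fact k \<le> 2 ^ n * ((t * m / 2) ^ k / fact k)"
      using t m by (simp add: power_divide divide_simps mult_right_mono)
    then have "((t * m) ^ k / fact k - 2 ^ n * ((t * m / 2) ^ k / fact k)) / m ^ n \<le> 0"
      using m by (intro divide_nonpos_nonneg) auto
    also have "0 \<le> anderson_power V k z / fact k * t ^ k"
      using t by (simp add: anderson_power_nonneg)
    finally show ?thesis .
  qed
  have ex: "?f x sums exp x" for x :: real
    using exp_converges[of x] by (simp add: field_simps)
  have sm: "(\<lambda>k. ((t * m) ^ k / fact k - 2 ^ n * ((t * m / 2) ^ k / fact k)) / m ^ n) sums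
      ((exp (t * m) - 2 ^ n * exp (t * m / 2)) / m ^ n)"
    by (intro sums_divide sums_diff sums_mult ex)
  have "2 ^ n * exp (t * m / 2) \<le> exp (t * m) / 2"
  proof -
    have "(2::real) ^ Suc n \<le> exp 1 ^ Suc n"
      using exp_ge_add_one_self[of 1] by (intro power_mono) auto
    also have "\<dots> = exp (real (Suc n))"
      using exp_of_nat_mult[of "Suc n" "1 :: real"] by (simp del: of_nat_Suc power_Suc)
    also have "\<dots> \<le> exp (t * m / 2)"
      using large by (simp add: n_def)
    finally have "2 ^ Suc n * exp (t * m / 2) \<le> exp (t * m / 2) * exp (t * m / 2)"
      by (intro mult_right_mono) auto
    then show ?thesis by (simp add: mult_ac flip: exp_add)
  qed
  then have "exp (t * m) / 2 / m ^ n \<le> (exp (t * m) - 2 ^ n * exp (t * m / 2)) / m ^ n"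
    using m by (intro divide_right_mono) auto
  also have "\<dots> \<le> (\<Sum>k. anderson_power V k z / fact k * t ^ k)"
    using sm termle by (intro sums_le[OF _ sm summable_sums[OF summable_series]]) auto
  finally have "exp (t * m) / 2 / m ^ n \<le> (\<Sum>k. anderson_power V k z / fact k * t ^ k)" .
  then have "exp (- (2 * real CARD('n)) * t) * (exp (t * m) / 2 / m ^ n)
      \<le> exp (- (2 * real CARD('n)) * t) * (\<Sum>k. anderson_power V k z / fact k * t ^ k)"
    by (intro mult_left_mono) auto
  also have "\<dots> = pam V t z"
    using t by (simp add: pam_eq pam_series_def anderson_series_def)
  finally have "exp (- (2 * real CARD('n)) * t) * (exp (t * m) / 2 / m ^ n) \<le> pam V t z" .
  also have "exp (- (2 * real CARD('n)) * t) * (exp (t * m) / 2 / m ^ n)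
      = exp (t * m - 2 * real CARD('n) * t - real n * ln m) / 2"
  proof -
    have "m ^ n = exp (real n * ln m)" using m by (simp add: exp_of_nat_mult)
    then show ?thesis by (simp add: exp_diff exp_minus exp_add field_simps)
  qed
  also have "pam V t z \<le> pam_total_mass V t"
    using t by (intro pam_le_total_mass) auto
  finally show ?thesis by (simp add: n_def)
qed

end

section \<open>Extremes of a Weibull field\<close>

text \<open>
  Disjoint cubes on dyadic scales. They make the maxima on different scales independent, while each
  of them still has the volume of the ball around the origin that contains it, up to a constant.
\<close>

definition cube :: "nat \<Rightarrow> (int ^ 'n) set" where
  "cube k = {z. \<forall>i. z $ i \<in> {2 ^ k <.. 2 ^ Suc k}}"

definition cube_radius :: "'n itself \<Rightarrow> nat \<Rightarrow> real" where
  "cube_radius _ k = real CARD('n) * 2 ^ Suc k"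

lemma finite_cube [simp]: "finite (cube k :: (int ^ 'n) set)"
  unfolding cube_def by (rule card_vec_all_components) simp

lemma card_cube: "card (cube k :: (int ^ 'n) set) = (2 ^ k) ^ CARD('n)"
  unfolding cube_def by (subst card_vec_all_components) (simp_all add: nat_power_eq)

lemma l1_cube_le:
  assumes "z \<in> (cube k :: (int ^ 'n) set)"
  shows "real (l1 z) \<le> cube_radius TYPE('n) k"
proof -
  have "nat \<bar>z $ i\<bar> \<le> 2 ^ Suc k" for i
  proof -
    have "2 ^ k < z $ i" "z $ i \<le> 2 ^ Suc k"
      using assms by (auto simp: cube_def)
    moreover have "(0::int) < 2 ^ k" by simp
    ultimately have "0 \<le> z $ i" "z $ i \<le> int (2 ^ Suc k)" by (linarith, simp)
    then show ?thesis by (simp only: abs_of_nonneg nat_le_iff)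
  qed
  then have "l1 z \<le> (\<Sum>i\<in>(UNIV :: 'n set). 2 ^ Suc k)"
    unfolding l1_def by (intro sum_mono) auto
  then have "real (l1 z) \<le> real (CARD('n) * 2 ^ Suc k)"
    by (simp only: sum_constant of_nat_le_iff) simp
  then show ?thesis by (simp add: cube_radius_def)
qed

lemma disjoint_cubes:
  assumes "j \<noteq> k"
  shows "cube j \<inter> cube k = {}"
proof -
  have "cube j \<inter> cube k = {}" if "j < k" for j k
  proof (rule ccontr)
    assume "cube j \<inter> (cube k :: (int ^ 'n) set) \<noteq> {}"
    then obtain z :: "int ^ 'n" where z: "z \<in> cube j" "z \<in> cube k" by auto
    then have "z $ i \<le> 2 ^ Suc j" "2 ^ k < z $ i" for i
      by (auto simp: cube_def)
    then have "(2::int) ^ k < 2 ^ Suc j"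
      using order.strict_trans2 by blast
    moreover have "(2::int) ^ Suc j \<le> 2 ^ k"
      using that by (intro power_increasing) auto
    ultimately show False by linarith
  qed
  then show ?thesis using assms by (metis inf_commute nat_neq_iff)
qed

text \<open>
  A property that is robust within a factor of two needs to be checked on dyadic radii only.
\<close>

lemma eventually_dyadic:
  assumes "0 < c" and ev: "eventually P sequentially"
    and imp: "\<And>k r. P k \<Longrightarrow> K \<le> k \<Longrightarrow> c * 2 ^ k \<le> r \<Longrightarrow> r \<le> c * 2 ^ Suc k \<Longrightarrow> Q r"
  shows "eventually Q (at_top :: real filter)"
proof -
  obtain N where N: "\<And>k. N \<le> k \<Longrightarrow> P k"
    using ev by (auto simp: eventually_sequentially)
  define L where "L = max N K"
  show ?thesis
    using eventually_ge_at_top[of "c * 2 ^ L"]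
  proof eventually_elim
    case (elim r)
    let ?k = "nat \<lfloor>log 2 (r / c)\<rfloor>"
    have pos: "2 ^ L \<le> r / c" using elim \<open>0 < c\<close> by (simp add: field_simps)
    then have rc: "0 < r / c" by (meson zero_less_numeral zero_less_power order_less_le_trans)
    have l: "real L \<le> log 2 (r / c)"
      using pos rc by (simp add: le_log_iff powr_realpow)
    have k: "L \<le> ?k" using l by (simp add: le_nat_floor)
    have "real ?k \<le> log 2 (r / c)" "log 2 (r / c) \<le> real (Suc ?k)"
      using l by linarith+
    then have "2 ^ ?k \<le> r / c" "r / c \<le> 2 ^ Suc ?k"
      using rc by (simp_all only: le_log_iff log_le_iff powr_realpow)
    then have "c * 2 ^ ?k \<le> r" "r \<le> c * 2 ^ Suc ?k"
      using \<open>0 < c\<close> by (simp_all add: field_simps)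
    then show "Q r"
      using imp[of ?k r] N[of ?k] k by (auto simp: L_def)
  qed
qed

text \<open>
  The threshold for the \<open>\<gamma>\<close>-th power of the field at radius \<open>r\<close>; the constant \<open>c\<close> measures the
  deviation from the leading order \<open>d ln r\<close> in units of \<open>ln ln r\<close>.
\<close>

definition level :: "real \<Rightarrow> real \<Rightarrow> real \<Rightarrow> real" where
  "level d c r = d * ln r + c * ln (ln r)"

lemma exp_minus_level:
  assumes "1 < r"
  shows "exp (- level d c r) = r powr (- d) * ln r powr (- c)"
  using assms by (simp add: level_def powr_def exp_add[symmetric])

lemma exp_one_less_3: "exp 1 < (3 :: real)"
  using e_less_272 by simp

lemma ln_ge_1: "3 \<le> r \<Longrightarrow> 1 \<le> ln (r :: real)"
  using exp_one_less_3 by (subst ln_ge_iff) auto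

lemma level_mono:
  assumes "3 \<le> r" "r \<le> s" "0 \<le> d" "0 \<le> c" "c \<le> c'"
  shows "level d c r \<le> level d c' s"
proof -
  have "1 \<le> ln r" "ln r \<le> ln s" using ln_ge_1 assms by auto
  then have "0 \<le> ln (ln r)" "ln (ln r) \<le> ln (ln s)" by auto
  then show ?thesis
    unfolding level_def using assms \<open>ln r \<le> ln s\<close> by (intro add_mono mult_mono) auto
qed

lemma level_nonneg:
  assumes "3 \<le> r" "1 \<le> d" "-1 \<le> c"
  shows "0 \<le> level d c r"
proof -
  have "1 \<le> ln r" using ln_ge_1 assms by auto
  then have 0: "0 \<le> ln (ln r)" "ln (ln r) \<le> ln r"
    using ln_le_minus_one[of "ln r"] by auto
  have "ln r \<le> d * ln r" using assms \<open>1 \<le> ln r\<close> by (simp add: mult_le_cancel_right1)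
  moreover have "- ln (ln r) \<le> c * ln (ln r)"
    using mult_right_mono[OF \<open>-1 \<le> c\<close> 0(1)] by simp
  ultimately show ?thesis using 0 by (simp add: level_def)
qed

text \<open>
  Some \<open>G k\<close> with \<open>k \<ge> K\<close> occurs almost surely as soon as the contrary event can be enclosed in events of
  arbitrarily small probability. Both ways of getting there are used below: one late \<open>k\<close> with
  \<open>G k\<close> very likely, and many independent \<open>G k\<close> whose probabilities have a divergent sum.
\<close>

lemma (in prob_space) AE_frequently_of_small_prob:
  assumes G: "\<And>k. G k \<in> events"
    and small: "\<And>K e. 0 < e \<Longrightarrow> \<exists>E\<in>events. {\<omega> \<in> space M. \<forall>k\<ge>K. \<omega> \<notin> G k} \<subseteq> E \<and> prob E \<le> e"
  shows "AE \<omega> in M. \<exists>\<^sub>F k in sequentially. \<omega> \<in> G k"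
proof -
  have "AE \<omega> in M. \<not> (\<forall>k\<ge>K. \<omega> \<notin> G k)" for K
  proof (rule AE_I[OF _ _ sets.sets_Collect_countable_All])
    let ?N = "{\<omega> \<in> space M. \<forall>k. K \<le> k \<longrightarrow> \<omega> \<notin> G k}"
    show m: "{\<omega> \<in> space M. K \<le> k \<longrightarrow> \<omega> \<notin> G k} \<in> events" for k
      using G by (intro sets.sets_Collect) auto
    have N: "?N \<in> events"
      by (rule sets.sets_Collect_countable_All[OF m])
    have "prob ?N \<le> 0"
    proof (rule field_le_epsilon)
      fix e :: real assume "0 < e"
      then obtain E where "E \<in> events" "?N \<subseteq> E" "prob E \<le> e" using small by blast
      then show "prob ?N \<le> 0 + e" using finite_measure_mono[of ?N E] by simp
    qed
    then have "prob ?N = 0" using measure_nonneg[of M ?N] by linarith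
    then show "emeasure M ?N = 0"
      by (simp add: emeasure_eq_measure)
  qed auto
  then have "AE \<omega> in M. \<forall>K. \<not> (\<forall>k\<ge>K. \<omega> \<notin> G k)"
    unfolding AE_all_countable by blast
  then show ?thesis
    by eventually_elim (auto simp: frequently_def eventually_sequentially)
qed

lemma (in prob_space) AE_eventually_of_summable:
  assumes B: "\<And>k. B k \<in> events" and sm: "summable g"
    and le: "eventually (\<lambda>k. prob (B k) \<le> g k) sequentially"
  shows "AE \<omega> in M. \<forall>\<^sub>F k in sequentially. \<omega> \<notin> B k"
proof -
  have "summable (\<lambda>k. prob (B k))"
    by (rule summable_comparison_test_ev[OF _ sm]) (use le in auto)
  then have "AE \<omega> in M. \<forall>\<^sub>F k in sequentially. \<omega> \<in> space M - B k"
    by (intro borel_cantelli_AE1 B) (auto simp: emeasure_eq_measure)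
  then show ?thesis by eventually_elim (auto elim: eventually_mono)
qed

locale weibull_field = prob_space M for M :: "'w measure" +
  fixes \<xi> :: "int ^ 'n \<Rightarrow> 'w \<Rightarrow> real" and \<gamma> :: real
  assumes \<gamma>_pos: "0 < \<gamma>"
    and indep: "indep_vars (\<lambda>_. borel) \<xi> UNIV"
    and distr: "prob {\<omega> \<in> space M. \<xi> z \<omega> \<le> x} = (if 0 \<le> x then 1 - exp (- (x powr \<gamma>)) else 0)"
begin

lemma dim_ge_1: "1 \<le> real CARD('n)"
  by (simp add: Suc_le_eq)

lemma measurable_\<xi> [measurable]: "\<xi> z \<in> borel_measurable M"
  using indep by (simp add: indep_vars_def)

lemma AE_nonneg: "AE \<omega> in M. \<forall>z. 0 \<le> \<xi> z \<omega>"
proof -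
  have "AE \<omega> in M. - inverse (real (Suc m)) < \<xi> z \<omega>" for m z
  proof (rule AE_I[where N = "{\<omega> \<in> space M. \<xi> z \<omega> \<le> - inverse (real (Suc m))}"])
    have "prob {\<omega> \<in> space M. \<xi> z \<omega> \<le> - inverse (real (Suc m))} = 0"
      by (subst distr) simp
    then show "emeasure M {\<omega> \<in> space M. \<xi> z \<omega> \<le> - inverse (real (Suc m))} = 0"
      by (simp add: emeasure_eq_measure)
  qed auto
  then have "AE \<omega> in M. \<forall>z m. - inverse (real (Suc m)) < \<xi> z \<omega>"
    unfolding AE_all_countable by blast
  then show ?thesis
  proof eventually_elim
    case (elim \<omega>)
    show ?case
    proof (rule allI, rule ccontr)
      fix z assume "\<not> 0 \<le> \<xi> z \<omega>"
      then obtain m where "inverse (real (Suc m)) < - \<xi> z \<omega>"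
        using reals_Archimedean[of "- \<xi> z \<omega>"] by auto
      then show False using elim[rule_format, of m z] by simp
    qed
  qed
qed

text \<open>
  The \<open>\<gamma>\<close>-th power of \<open>\<xi> z\<close> has the standard exponential distribution.
\<close>

lemma prob_le_powr:
  assumes "0 \<le> x"
  shows "prob {\<omega> \<in> space M. \<xi> z \<omega> \<le> x powr (1 / \<gamma>)} = 1 - exp (- x)"
  using assms \<gamma>_pos by (simp add: distr powr_powr)

lemma prob_gt_powr:
  assumes "0 \<le> x"
  shows "prob {\<omega> \<in> space M. x powr (1 / \<gamma>) < \<xi> z \<omega>} = exp (- x)"
proof -
  have "{\<omega> \<in> space M. x powr (1 / \<gamma>) < \<xi> z \<omega>} = space M - {\<omega> \<in> space M. \<xi> z \<omega> \<le> x powr (1 / \<gamma>)}"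
    by auto
  then show ?thesis
    by (simp add: prob_compl prob_le_powr assms)
qed

lemma prob_all_le:
  assumes "finite J" and x: "\<And>z. z \<in> J \<Longrightarrow> 0 \<le> x z"
  shows "prob {\<omega> \<in> space M. \<forall>z\<in>J. \<xi> z \<omega> \<le> x z powr (1 / \<gamma>)} \<le> exp (- (\<Sum>z\<in>J. exp (- x z)))"
proof (cases "J = {}")
  case True
  then show ?thesis by simp
next
  case False
  have "{\<omega> \<in> space M. \<forall>z\<in>J. \<xi> z \<omega> \<le> x z powr (1 / \<gamma>)}
      = (\<Inter>z\<in>J. \<xi> z -` {..x z powr (1 / \<gamma>)} \<inter> space M)"
    using False by auto
  also have "prob \<dots> = (\<Prod>z\<in>J. prob (\<xi> z -` {..x z powr (1 / \<gamma>)} \<inter> space M))"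
    by (rule indep_varsD[OF indep False \<open>finite J\<close>]) auto
  also have "\<dots> = (\<Prod>z\<in>J. 1 - exp (- x z))"
  proof (rule prod.cong)
    fix z assume "z \<in> J"
    have "\<xi> z -` {..x z powr (1 / \<gamma>)} \<inter> space M = {\<omega> \<in> space M. \<xi> z \<omega> \<le> x z powr (1 / \<gamma>)}"
      by auto
    then show "prob (\<xi> z -` {..x z powr (1 / \<gamma>)} \<inter> space M) = 1 - exp (- x z)"
      using prob_le_powr x \<open>z \<in> J\<close> by simp
  qed simp
  also have "\<dots> \<le> (\<Prod>z\<in>J. exp (- exp (- x z)))"
    using x exp_ge_add_one_self[of "- exp (- x z)" for z] by (intro prod_mono) auto
  also have "\<dots> = exp (- (\<Sum>z\<in>J. exp (- x z)))"
    using \<open>finite J\<close> by (simp add: exp_sum sum_negf[symmetric])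
  finally show ?thesis .
qed

lemma prob_ex_gt:
  assumes "finite J" "0 \<le> x"
  shows "prob {\<omega> \<in> space M. \<exists>z\<in>J. x powr (1 / \<gamma>) < \<xi> z \<omega>} \<le> real (card J) * exp (- x)"
proof -
  have "{\<omega> \<in> space M. \<exists>z\<in>J. x powr (1 / \<gamma>) < \<xi> z \<omega>}
      = (\<Union>z\<in>J. {\<omega> \<in> space M. x powr (1 / \<gamma>) < \<xi> z \<omega>})"
    by auto
  also have "prob \<dots> \<le> (\<Sum>z\<in>J. prob {\<omega> \<in> space M. x powr (1 / \<gamma>) < \<xi> z \<omega>})"
    using assms by (intro finite_measure_subadditive_finite) auto
  also have "\<dots> = real (card J) * exp (- x)"
    using assms by (simp add: prob_gt_powr)
  finally show ?thesis .
qed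

text \<open>
  The union bound: the volume of the ball cancels the factor \<open>r powr (- d)\<close> in the tail at the level
  \<open>d ln r + c ln ln r\<close>, and \<open>(ln r) powr (- c)\<close> remains.
\<close>

lemma prob_ball_exceeds:
  assumes "2 \<le> k" "0 \<le> c"
  shows "prob {\<omega> \<in> space M. \<exists>z\<in>{z. l1 z \<le> 2 ^ (k + j)}. level (real CARD('n)) c (2 ^ k) powr (1 / \<gamma>) < \<xi> z \<omega>}
     \<le> (2 * 2 ^ j + 1) ^ CARD('n) * (ln 2 * real k) powr (- c)"
proof -
  have k4: "(4::real) \<le> 2 ^ k"
    using power_increasing[of 2 k "2::real"] assms by simp
  have "prob {\<omega> \<in> space M. \<exists>z\<in>{z. l1 z \<le> 2 ^ (k + j)}. level (real CARD('n)) c (2 ^ k) powr (1 / \<gamma>) < \<xi> z \<omega>}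
      \<le> real (card {z :: int ^ 'n. l1 z \<le> 2 ^ (k + j)}) * exp (- level (real CARD('n)) c (2 ^ k))"
    using k4 assms dim_ge_1 by (intro prob_ex_gt level_nonneg) auto
  also have "\<dots> \<le> real ((2 * 2 ^ (k + j) + 1) ^ CARD('n)) * exp (- level (real CARD('n)) c (2 ^ k))"
    by (intro mult_right_mono of_nat_mono card_l1_ball_le) auto
  also have "real ((2 * 2 ^ (k + j) + 1) ^ CARD('n)) \<le> ((2 * 2 ^ j + 1) * 2 ^ k) ^ CARD('n)"
    using k4 by (simp add: power_add algebra_simps power_mono)
  also have "\<dots> * exp (- level (real CARD('n)) c (2 ^ k)) = (2 * 2 ^ j + 1) ^ CARD('n) * (ln 2 * real k) powr (- c)"
  proof -
    have "(2 ^ k) powr (- real CARD('n)) = inverse ((2 ^ k) ^ CARD('n))"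
      by (simp add: powr_minus powr_realpow)
    then show ?thesis
      using k4 by (subst exp_minus_level) (auto simp: power_mult_distrib ln_realpow mult_ac)
  qed
  finally show ?thesis by (simp add: mult_right_mono)
qed

text \<open>
  Along \<open>r = 2\<^sup>k\<close> the bound of \<open>prob_ball_exceeds\<close> is of order \<open>k powr (- 1 - \<epsilon>)\<close>, which is summable. The
  ball of radius \<open>2\<^sup>k\<^sup>+\<^sup>1\<close> is compared with the level at \<open>2\<^sup>k\<close>, so that all radii in between are covered.
\<close>

lemma AE_eventually_below:
  assumes "0 < \<epsilon>"
  shows "AE \<omega> in M. \<forall>\<^sub>F r in at_top. \<forall>z. real (l1 z) \<le> r \<longrightarrow> \<xi> z \<omega> \<le> level (real CARD('n)) (1 + \<epsilon>) r powr (1 / \<gamma>)"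
proof -
  let ?B = "\<lambda>k. {\<omega> \<in> space M. \<exists>z\<in>{z. l1 z \<le> 2 ^ (k + 1)}. level (real CARD('n)) (1 + \<epsilon>) (2 ^ k) powr (1 / \<gamma>) < \<xi> z \<omega>}"
  let ?g = "\<lambda>k. (2 * 2 ^ 1 + 1) ^ CARD('n) * (ln 2 * real k) powr (- (1 + \<epsilon>))"
  have "AE \<omega> in M. \<forall>\<^sub>F k in sequentially. \<omega> \<notin> ?B k"
  proof (rule AE_eventually_of_summable)
    show "?B k \<in> events" for k by measurable
    have "summable (\<lambda>k. real k powr (- (1 + \<epsilon>)))"
      using assms by (subst summable_real_powr_iff) auto
    then show "summable ?g"
      by (intro summable_mult) (simp add: powr_mult summable_mult)
    show "\<forall>\<^sub>F k in sequentially. prob (?B k) \<le> ?g k"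
      using eventually_ge_at_top[of 2]
      by eventually_elim (rule prob_ball_exceeds, use assms in auto)
  qed
  moreover have "AE \<omega> in M. \<omega> \<in> space M" by (rule AE_space)
  ultimately show ?thesis
  proof eventually_elim
    case (elim \<omega>)
    show ?case
    proof (rule eventually_dyadic[where c = 1 and K = 2, OF _ elim(1)])
      fix k :: nat and r :: real
      assume k: "\<omega> \<notin> ?B k" "2 \<le> k" "1 * 2 ^ k \<le> r" "r \<le> 1 * 2 ^ Suc k"
      have k4: "(4::real) \<le> 2 ^ k"
        using power_increasing[of 2 k "2::real"] k by simp
      show "\<forall>z. real (l1 z) \<le> r \<longrightarrow> \<xi> z \<omega> \<le> level (real CARD('n)) (1 + \<epsilon>) r powr (1 / \<gamma>)"
      proof (intro allI impI)
        fix z :: "int ^ 'n" assume "real (l1 z) \<le> r"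
        then have "real (l1 z) \<le> real (2 ^ Suc k)" using k by simp
        then have "l1 z \<le> 2 ^ (k + 1)" by (simp only: of_nat_le_iff) simp
        then have "\<xi> z \<omega> \<le> level (real CARD('n)) (1 + \<epsilon>) (2 ^ k) powr (1 / \<gamma>)"
          using k(1) elim(2) by (auto simp: not_less)
        also have "\<dots> \<le> level (real CARD('n)) (1 + \<epsilon>) r powr (1 / \<gamma>)"
          using k k4 assms \<gamma>_pos dim_ge_1 by (intro powr_mono2 level_mono level_nonneg) auto
        finally show "\<xi> z \<omega> \<le> level (real CARD('n)) (1 + \<epsilon>) r powr (1 / \<gamma>)" .
      qed
    qed simp
  qed
qed

text \<open>
  The bound of \<open>prob_ball_exceeds\<close> is now of order \<open>k powr (- \<epsilon>)\<close>. It tends to \<open>0\<close>, so arbitrarily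
  late scales are good with probability arbitrarily close to \<open>1\<close>.
\<close>

lemma AE_frequently_below:
  assumes "0 < \<epsilon>"
  shows "AE \<omega> in M. \<exists>\<^sub>F r in at_top. \<forall>z. real (l1 z) \<le> r \<longrightarrow> \<xi> z \<omega> \<le> level (real CARD('n)) \<epsilon> r powr (1 / \<gamma>)"
proof -
  let ?B = "\<lambda>k. {\<omega> \<in> space M. \<exists>z\<in>{z. l1 z \<le> 2 ^ (k + 0)}. level (real CARD('n)) \<epsilon> (2 ^ k) powr (1 / \<gamma>) < \<xi> z \<omega>}"
  let ?g = "\<lambda>k. (2 * 2 ^ 0 + 1) ^ CARD('n) * (ln 2 * real k) powr (- \<epsilon>)"
  have B: "?B k \<in> events" for k by measurable
  have lim: "?g \<longlonglongrightarrow> 0"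
    using assms by real_asymp
  have "AE \<omega> in M. \<exists>\<^sub>F k in sequentially. \<omega> \<in> space M - ?B k"
  proof (rule AE_frequently_of_small_prob)
    show "space M - ?B k \<in> events" for k using B by auto
    fix K :: nat and e :: real assume "0 < e"
    then have "\<forall>\<^sub>F k in sequentially. ?g k < e"
      using order_tendstoD(2)[OF lim] by simp
    then have "\<forall>\<^sub>F k in sequentially. ?g k < e \<and> K \<le> k \<and> 2 \<le> k"
      by (intro eventually_conj eventually_ge_at_top)
    then obtain k where k: "?g k < e" "K \<le> k" "2 \<le> k"
      by (auto simp: eventually_sequentially)
    have "prob (?B k) \<le> ?g k"
      using k assms by (intro prob_ball_exceeds) auto
    then show "\<exists>E\<in>events. {\<omega> \<in> space M. \<forall>k\<ge>K. \<omega> \<notin> space M - ?B k} \<subseteq> E \<and> prob E \<le> e"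
      using k B by (intro bexI[of _ "?B k"]) auto
  qed
  then show ?thesis
  proof eventually_elim
    case (elim \<omega>)
    have f: "\<exists>\<^sub>F k in sequentially. \<forall>z. real (l1 z) \<le> 2 ^ k \<longrightarrow> \<xi> z \<omega> \<le> level (real CARD('n)) \<epsilon> (2 ^ k) powr (1 / \<gamma>)"
      using elim
    proof (rule frequently_elim1)
      fix k assume k: "\<omega> \<in> space M - ?B k"
      show "\<forall>z. real (l1 z) \<le> 2 ^ k \<longrightarrow> \<xi> z \<omega> \<le> level (real CARD('n)) \<epsilon> (2 ^ k) powr (1 / \<gamma>)"
      proof (intro allI impI)
        fix z :: "int ^ 'n" assume "real (l1 z) \<le> 2 ^ k"
        then have "real (l1 z) \<le> real (2 ^ k)" by simp
        then have "l1 z \<le> 2 ^ (k + 0)" by (simp only: of_nat_le_iff) simp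
        then show "\<xi> z \<omega> \<le> level (real CARD('n)) \<epsilon> (2 ^ k) powr (1 / \<gamma>)"
          using k by (auto simp: not_less)
      qed
    qed
    have "filterlim (\<lambda>k::nat. 2 ^ k :: real) at_top sequentially"
      by real_asymp
    then show ?case
      using f unfolding frequently_def filterlim_iff by blast
  qed
qed

lemma cube_radius_ge: "1 \<le> k \<Longrightarrow> 4 \<le> cube_radius TYPE('n) k"
proof -
  assume "1 \<le> k"
  then have "(2::real) ^ 2 \<le> 2 ^ Suc k" by (intro power_increasing) auto
  then have "1 * 4 \<le> real CARD('n) * 2 ^ Suc k" using dim_ge_1 by (intro mult_mono) auto
  then show ?thesis by (simp add: cube_radius_def)
qed

text \<open>
  On the \<open>k\<close>-th cube the expected number of sites above the level is of order \<open>1 / k\<close>. The harmonic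
  series diverges and the cubes are disjoint, so independence forces infinitely many successes.
\<close>

lemma AE_frequently_above:
  "AE \<omega> in M. \<exists>\<^sub>F r in at_top. \<exists>z. real (l1 z) \<le> r \<and> level (real CARD('n)) 1 r powr (1 / \<gamma>) \<le> \<xi> z \<omega>"
proof -
  let ?R = "cube_radius TYPE('n)"
  let ?h = "\<lambda>k. level (real CARD('n)) 1 (?R k)"
  let ?G = "\<lambda>k. {\<omega> \<in> space M. \<exists>z\<in>cube k. ?h k powr (1 / \<gamma>) < \<xi> z \<omega>}"
  have R: "exp (- ?h k) = inverse ((2 * real CARD('n)) ^ CARD('n)) * inverse ((2 ^ k) ^ CARD('n)) * inverse (ln (?R k))"
    if "1 \<le> k" for k
  proof -
    have "4 \<le> ?R k" by (rule cube_radius_ge[OF that])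
    moreover have "?R k powr (- real CARD('n)) = inverse ((2 * real CARD('n)) ^ CARD('n)) * inverse ((2 ^ k) ^ CARD('n))"
      using \<open>4 \<le> ?R k\<close> by (simp add: powr_minus powr_realpow cube_radius_def power_mult_distrib mult_ac)
    moreover have "1 \<le> ln (?R k)" using ln_ge_1 \<open>4 \<le> ?R k\<close> by simp
    ultimately show ?thesis
      by (subst exp_minus_level) (auto simp: powr_minus)
  qed
  have diverge: "\<exists>L. B \<le> (\<Sum>k = K..<L. inverse (ln (?R k)))" if K: "1 \<le> K" for K :: nat and B :: real
  proof (rule ccontr)
    assume "\<not> ?thesis"
    then have lt: "(\<Sum>k = K..<L. inverse (ln (?R k))) < B" for L by (simp add: not_le)
    have pos: "1 \<le> ln (?R k)" if "1 \<le> k" for k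
      using cube_radius_ge[OF that] ln_ge_1 by simp
    have "summable (\<lambda>k. inverse (ln (?R (k + K))))"
    proof (rule summableI_nonneg_bounded)
      show "0 \<le> inverse (ln (?R (k + K)))" for k
        using pos[of "k + K"] K by simp
      show "(\<Sum>k<n. inverse (ln (?R (k + K)))) \<le> B" for n
        using lt[of "n + K"] sum.shift_bounds_nat_ivl[of "\<lambda>k. inverse (ln (?R k))" 0 K n]
        by (simp add: lessThan_atLeast0)
    qed
    then have sm: "summable (\<lambda>k. inverse (ln (?R k)))"
      by (rule summable_iff_shift[of "\<lambda>k. inverse (ln (?R k))" K, THEN iffD1])
    define C where "C = ln (real CARD('n)) + 2 * ln 2"
    have "0 \<le> ln (real CARD('n))" using dim_ge_1 by simp
    then have C: "0 < C" by (simp add: C_def add_nonneg_pos)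
    have "summable (\<lambda>k. inverse (real k))"
    proof (rule summable_comparison_test_ev[OF _ summable_mult[OF sm, of C]])
      show "\<forall>\<^sub>F k in sequentially. norm (inverse (real k)) \<le> C * inverse (ln (?R k))"
        using eventually_ge_at_top[of 1]
      proof eventually_elim
        case (elim k)
        have "ln (?R k) = ln (real CARD('n)) + real (Suc k) * ln 2"
          using dim_ge_1 by (simp add: cube_radius_def ln_mult ln_realpow del: power_Suc)
        also have "\<dots> \<le> ln (real CARD('n)) * real k + (2 * real k) * ln 2"
          using elim \<open>0 \<le> ln (real CARD('n))\<close> by (intro add_mono mult_right_mono) (auto simp: mult_le_cancel_left1)
        also have "\<dots> = C * real k" by (simp add: C_def algebra_simps)
        finally show ?case
          using pos[OF elim] elim C by (simp add: field_simps)
      qed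
    qed
    then show False using not_summable_harmonic[where 'a = real] by simp
  qed
  have "AE \<omega> in M. \<exists>\<^sub>F k in sequentially. \<omega> \<in> ?G k"
  proof (rule AE_frequently_of_small_prob)
    show "?G k \<in> events" for k by measurable
    fix K0 :: nat and e :: real assume e: "0 < e"
    define K where "K = max 1 K0"
    obtain L where L: "(2 * real CARD('n)) ^ CARD('n) * (- ln e) \<le> (\<Sum>k = K..<L. inverse (ln (?R k)))"
      using diverge[of K] by (auto simp: K_def)
    define J :: "(int ^ 'n) set" where "J = (\<Union>k\<in>{K..<L}. cube k)"
    \<comment> \<open>The scale of a site, so that all cubes with \<open>K \<le> k < L\<close> can be treated as one family of sites with site-dependent thresholds.\<close>
    define \<kappa> where "\<kappa> z = (SOME k. z \<in> cube k)" for z :: "int ^ 'n"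
    have \<kappa>: "\<kappa> z = k" if "z \<in> cube k" for k z
    proof -
      have "z \<in> cube (\<kappa> z)" unfolding \<kappa>_def using that by (rule someI)
      then show ?thesis using disjoint_cubes[of "\<kappa> z" k] that by auto
    qed
    let ?E = "{\<omega> \<in> space M. \<forall>z\<in>J. \<xi> z \<omega> \<le> ?h (\<kappa> z) powr (1 / \<gamma>)}"
    have J: "finite J" by (simp add: J_def)
    have K1: "1 \<le> k" if "k \<in> {K..<L}" for k using that by (auto simp: K_def)
    have "- ln e \<le> inverse ((2 * real CARD('n)) ^ CARD('n)) * (\<Sum>k = K..<L. inverse (ln (?R k)))"
      using L dim_ge_1 by (simp add: field_simps)
    also have "\<dots> = (\<Sum>k = K..<L. real (card (cube k :: (int ^ 'n) set)) * exp (- ?h k))"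
      unfolding sum_distrib_left
    proof (rule sum.cong)
      fix k assume k: "k \<in> {K..<L}"
      show "inverse ((2 * real CARD('n)) ^ CARD('n)) * inverse (ln (?R k)) = real (card (cube k :: (int ^ 'n) set)) * exp (- ?h k)"
        unfolding R[OF K1[OF k]] card_cube by simp
    qed simp
    also have "\<dots> = (\<Sum>k = K..<L. \<Sum>z\<in>(cube k :: (int ^ 'n) set). exp (- ?h (\<kappa> z)))"
    proof (rule sum.cong)
      fix k
      have "(\<Sum>z\<in>(cube k :: (int ^ 'n) set). exp (- ?h (\<kappa> z))) = (\<Sum>z\<in>(cube k :: (int ^ 'n) set). exp (- ?h k))"
        by (intro sum.cong refl) (simp add: \<kappa>)
      then show "real (card (cube k :: (int ^ 'n) set)) * exp (- ?h k) = (\<Sum>z\<in>(cube k :: (int ^ 'n) set). exp (- ?h (\<kappa> z)))"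
        by simp
    qed simp
    also have "\<dots> = (\<Sum>z\<in>J. exp (- ?h (\<kappa> z)))"
      unfolding J_def by (rule sum.UNION_disjoint[symmetric]) (auto simp: disjoint_cubes)
    finally have sum_ge: "- ln e \<le> (\<Sum>z\<in>J. exp (- ?h (\<kappa> z)))" .
    have "prob ?E \<le> exp (- (\<Sum>z\<in>J. exp (- ?h (\<kappa> z))))"
    proof (rule prob_all_le[OF J])
      fix z assume "z \<in> J"
      then obtain k where k: "z \<in> cube k" "k \<in> {K..<L}" by (auto simp: J_def)
      then have "4 \<le> ?R (\<kappa> z)" using \<kappa> K1 cube_radius_ge by simp
      then show "0 \<le> ?h (\<kappa> z)" using dim_ge_1 by (intro level_nonneg) auto
    qed
    also have "\<dots> \<le> exp (ln e)" using sum_ge by simp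
    also have "\<dots> = e" using e by simp
    finally have "prob ?E \<le> e" .
    moreover have "?E \<in> events" using J by measurable
    moreover have "{\<omega> \<in> space M. \<forall>k\<ge>K0. \<omega> \<notin> ?G k} \<subseteq> ?E"
      by (auto simp: J_def K_def \<kappa> not_less)
    ultimately show "\<exists>E\<in>events. {\<omega> \<in> space M. \<forall>k\<ge>K0. \<omega> \<notin> ?G k} \<subseteq> E \<and> prob E \<le> e" by blast
  qed
  then show ?thesis
  proof eventually_elim
    case (elim \<omega>)
    have "\<exists>\<^sub>F k in sequentially. \<exists>z. real (l1 z) \<le> ?R k \<and> level (real CARD('n)) 1 (?R k) powr (1 / \<gamma>) \<le> \<xi> z \<omega>"
      using elim by (rule frequently_elim1) (auto intro: l1_cube_le less_imp_le)
    moreover have "filterlim ?R at_top sequentially"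
      unfolding cube_radius_def using dim_ge_1 by real_asymp
    ultimately show ?case
      unfolding frequently_def filterlim_iff by blast
  qed
qed

text \<open>
  The expected number of sites above the level is now of order \<open>k powr \<epsilon>\<close>, so the probability that there
  is none is at most \<open>exp (- c k powr \<epsilon>)\<close>, which is summable. The threshold mixes \<open>ln R\<^sub>k\<^sub>+\<^sub>1\<close> and
  \<open>ln ln R\<^sub>k\<close> in order to dominate the level at every radius between \<open>R\<^sub>k\<close> and \<open>R\<^sub>k\<^sub>+\<^sub>1\<close>.
\<close>

lemma AE_eventually_above:
  assumes "0 < \<epsilon>" "\<epsilon> \<le> 1"
  shows "AE \<omega> in M. \<forall>\<^sub>F r in at_top. \<exists>z. real (l1 z) \<le> r \<and> level (real CARD('n)) (- \<epsilon>) r powr (1 / \<gamma>) \<le> \<xi> z \<omega>"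
proof -
  let ?R = "cube_radius TYPE('n)"
  let ?x = "\<lambda>k. real CARD('n) * ln (?R (Suc k)) - \<epsilon> * ln (ln (?R k))"
  let ?B = "\<lambda>k. {\<omega> \<in> space M. \<forall>z\<in>cube k. \<xi> z \<omega> \<le> ?x k powr (1 / \<gamma>)}"
  let ?c = "inverse ((4 * real CARD('n)) ^ CARD('n))"
  have Rle: "?R k \<le> ?R (Suc k)" for k
    by (simp add: cube_radius_def)
  have x_nonneg: "0 \<le> ?x k" if "1 \<le> k" for k
  proof -
    have "0 \<le> level (real CARD('n)) (- \<epsilon>) (?R k)"
      using cube_radius_ge[OF that] assms dim_ge_1 by (intro level_nonneg) auto
    moreover have "real CARD('n) * ln (?R k) \<le> real CARD('n) * ln (?R (Suc k))"
      using Rle[of k] cube_radius_ge[OF that] by (intro mult_left_mono) auto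
    ultimately show ?thesis unfolding level_def by linarith
  qed
  have bound: "prob (?B k) \<le> exp (- (?c * (ln 2 * real k) powr \<epsilon>))" if k: "1 \<le> k" for k
  proof -
    have R4: "4 \<le> ?R k" by (rule cube_radius_ge[OF k])
    then have l: "1 \<le> ln (?R k)" using ln_ge_1 by simp
    have "?R k = real CARD('n) * 2 ^ Suc k" by (simp add: cube_radius_def)
    then have "ln (?R k) = ln (real CARD('n)) + real (Suc k) * ln 2"
      using dim_ge_1 by (simp add: ln_mult ln_realpow del: power_Suc)
    moreover have "0 \<le> ln (real CARD('n))" using dim_ge_1 by simp
    ultimately have lk: "ln 2 * real k \<le> ln (?R k)" by (simp add: algebra_simps)
    have "exp (- ?x k) = ?R (Suc k) powr (- real CARD('n)) * ln (?R k) powr \<epsilon>"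
      using R4 Rle[of k] l by (simp add: powr_def exp_add[symmetric])
    also have "?R (Suc k) powr (- real CARD('n)) = ?c * inverse ((2 ^ k) ^ CARD('n))"
      using R4 Rle[of k] by (simp add: powr_minus powr_realpow) (simp add: cube_radius_def power_mult_distrib mult_ac)
    finally have "real (card (cube k :: (int ^ 'n) set)) * exp (- ?x k) = ?c * ln (?R k) powr \<epsilon>"
      by (simp add: card_cube)
    moreover have "?c * (ln 2 * real k) powr \<epsilon> \<le> ?c * ln (?R k) powr \<epsilon>"
      using lk assms by (intro mult_left_mono powr_mono2) auto
    moreover have "prob (?B k) \<le> exp (- (\<Sum>z\<in>(cube k :: (int ^ 'n) set). exp (- ?x k)))"
      by (rule prob_all_le) (use x_nonneg[OF k] in auto)
    ultimately have "prob (?B k) \<le> exp (- (?c * ln (?R k) powr \<epsilon>))"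
        "exp (- (?c * ln (?R k) powr \<epsilon>)) \<le> exp (- (?c * (ln 2 * real k) powr \<epsilon>))"
      by auto
    then show ?thesis by linarith
  qed
  have "AE \<omega> in M. \<forall>\<^sub>F k in sequentially. \<omega> \<notin> ?B k"
  proof (rule AE_eventually_of_summable)
    show "?B k \<in> events" for k by measurable
    show "summable (\<lambda>k. real k powr (-2))"
      by (subst summable_real_powr_iff) auto
    have c: "0 < ?c" using dim_ge_1 by simp
    have "\<forall>\<^sub>F k in sequentially. exp (- (c * (ln 2 * real k) powr \<epsilon>)) \<le> real k powr (-2)" if "0 < c" for c
      using that assms by real_asymp
    from this[OF c] show "\<forall>\<^sub>F k in sequentially. prob (?B k) \<le> real k powr (-2)"
      using eventually_ge_at_top[of 1] by eventually_elim (use bound order_trans in blast)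
  qed
  moreover have "AE \<omega> in M. \<omega> \<in> space M" by (rule AE_space)
  ultimately show ?thesis
  proof eventually_elim
    case (elim \<omega>)
    show ?case
    proof (rule eventually_dyadic[where c = "2 * real CARD('n)" and K = 1, OF _ elim(1)])
      fix k :: nat and r :: real
      assume k: "\<omega> \<notin> ?B k" "1 \<le> k" "2 * real CARD('n) * 2 ^ k \<le> r" "r \<le> 2 * real CARD('n) * 2 ^ Suc k"
      then have r: "?R k \<le> r" "r \<le> ?R (Suc k)" by (simp_all add: cube_radius_def mult_ac)
      have R4: "4 \<le> ?R k" by (rule cube_radius_ge[OF k(2)])
      then have l: "1 \<le> ln (?R k)" using ln_ge_1 by simp
      obtain z :: "int ^ 'n" where z: "z \<in> cube k" "?x k powr (1 / \<gamma>) < \<xi> z \<omega>"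
        using k(1) elim(2) by (auto simp: not_le)
      have "\<epsilon> * ln (ln (?R k)) \<le> \<epsilon> * ln (ln r)"
        using assms R4 r l by (intro mult_left_mono) (auto simp: ln_le_cancel_iff)
      moreover have "real CARD('n) * ln r \<le> real CARD('n) * ln (?R (Suc k))"
        using R4 r by (intro mult_left_mono) auto
      ultimately have "level (real CARD('n)) (- \<epsilon>) r \<le> ?x k"
        unfolding level_def by linarith
      moreover have "0 \<le> level (real CARD('n)) (- \<epsilon>) r"
        using R4 r assms dim_ge_1 by (intro level_nonneg) auto
      ultimately have "level (real CARD('n)) (- \<epsilon>) r powr (1 / \<gamma>) \<le> ?x k powr (1 / \<gamma>)"
        using \<gamma>_pos by (intro powr_mono2) auto
      then show "\<exists>z. real (l1 z) \<le> r \<and> level (real CARD('n)) (- \<epsilon>) r powr (1 / \<gamma>) \<le> \<xi> z \<omega>"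
        using z l1_cube_le[OF z(1)] r by (intro exI[of _ z]) auto
    qed (use dim_ge_1 in auto)
  qed
qed

end

section \<open>Asymptotics of the growth rate\<close>

lemma powr_add_diff_le:
  assumes "0 < y" "0 \<le> h" "1 \<le> (a :: real)"
  shows "(y + h) powr a - y powr a \<le> a * h * (y + h) powr (a - 1)"
proof (cases "h = 0")
  case False
  have "\<exists>z. y < z \<and> z < y + h \<and> (y + h) powr a - y powr a = (y + h - y) * (a * z powr (a - 1))"
    using assms False by (intro MVT2) (auto intro!: has_real_derivative_powr)
  then obtain z where z: "y < z" "z < y + h" "(y + h) powr a - y powr a = (y + h - y) * (a * z powr (a - 1))"
    by blast
  have "h * (a * z powr (a - 1)) \<le> h * (a * (y + h) powr (a - 1))"
    using z assms by (intro mult_left_mono powr_mono2) auto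
  then show ?thesis using z(3) by (simp add: mult_ac)
qed simp

lemma power_over_fact_le: "real n ^ n / fact n \<le> exp (real n)"
proof -
  have "real n ^ n / fact n \<le> (\<Sum>j<Suc n. real n ^ j / fact j)"
    by (intro member_le_sum) auto
  then show ?thesis
    using sum_exp_series_le[of "real n" "Suc n"] by linarith
qed

lemma level_scale:
  assumes "1 < t"
  shows "level d \<kappa> (t * ln t powr b) = d * (ln t + b * ln (ln t)) + \<kappa> * ln (ln t + b * ln (ln t))"
proof -
  have "ln (t * ln t powr b) = ln t + b * ln (ln t)"
    using assms by (simp add: ln_mult)
  then show ?thesis by (simp add: level_def)
qed

text \<open>
  Sites at distance \<open>n = t s\<close> with \<open>s \<ge> (ln t) powr b\<close> and \<open>b > a - 1\<close>. Reaching them costs about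
  \<open>s ln s\<close> per unit of time. What they offer beyond \<open>(d ln t) powr a\<close> is by the mean value theorem
  about \<open>(ln t) powr (a - 1)\<close> up to powers of \<open>ln s\<close>. Since \<open>ln t \<le> s powr (1 / b)\<close> this is
  at most \<open>s powr ((a - 1) / b)\<close> up to such factors, and the exponent is less than \<open>1\<close>. Eliminating \<open>t\<close> in this way makes the estimate
  uniform in \<open>s\<close>. The term \<open>- 2\<close> covers Stirling's \<open>e\<^sup>n\<close> and leaves \<open>e\<^sup>-\<^sup>n\<close> for summability.
\<close>

lemma far_sites_negligible:
  fixes a b d :: real
  assumes a: "1 < a" "a - 1 < b" and d: "0 < d"
  shows "\<forall>\<^sub>F t in at_top. \<forall>s \<ge> ln t powr b.
           level d 2 (t * s) powr a - (d * ln t) powr a \<le> s * (ln s - ln (2 * d) - 2)"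
proof -
  define q where "q = 1 / b"
  have b: "0 < b" using a by simp
  have q: "0 < q" "q * (a - 1) < 1" using a b by (auto simp: q_def)
  define H where "H s = d * ln s + 2 * ln (2 * s powr (q + 1))" for s
  have "\<forall>\<^sub>F s in at_top. a * H s * (d * s powr q + H s) powr (a - 1) \<le> s * (ln s - ln (2 * d) - 2)"
    unfolding H_def using a(1) q d by real_asymp
  then obtain S where S: "\<And>s. S \<le> s \<Longrightarrow> a * H s * (d * s powr q + H s) powr (a - 1) \<le> s * (ln s - ln (2 * d) - 2)"
    by (auto simp: eventually_at_top_linorder)
  have "\<forall>\<^sub>F t in at_top. max S 3 \<le> ln t powr b"
    using b by real_asymp
  moreover have "\<forall>\<^sub>F t in at_top. 1 \<le> ln (t :: real)"
    by real_asymp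
  ultimately show ?thesis
    using eventually_gt_at_top[of 0]
  proof eventually_elim
    case (elim t)
    define x where "x = ln t"
    show ?case
    proof (intro allI impI)
      fix s assume s: "ln t powr b \<le> s"
      have s3: "3 \<le> s" "S \<le> s" using s elim by auto
      have x: "1 \<le> x" using elim by (simp add: x_def)
      have ls: "1 \<le> ln s" using ln_ge_1 s3 by simp
      have "x = (x powr b) powr q" using x b by (simp add: powr_powr q_def)
      also have "\<dots> \<le> s powr q" using s q x by (intro powr_mono2) (auto simp: x_def)
      finally have xq: "x \<le> s powr q" .
      have "s powr q \<le> s powr (q + 1)" using s3 by (intro powr_mono) auto
      moreover have "s powr 1 \<le> s powr (q + 1)" using s3 q by (intro powr_mono) auto
      moreover have "ln s \<le> s" using ln_le_minus_one[of s] s3 by simp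
      moreover have "s powr 1 = s" using s3 by simp
      ultimately have xs: "x + ln s \<le> 2 * s powr (q + 1)" using xq by linarith
      \<comment> \<open>The increment of the argument of \<open>powr a\<close>; the function \<open>H\<close> bounds it in terms of \<open>s\<close> alone.\<close>
      define h where "h = d * ln s + 2 * ln (x + ln s)"
      have h: "0 \<le> h" using x ls d by (simp add: h_def)
      have "ln (x + ln s) \<le> ln (2 * s powr (q + 1))"
        using xs x ls s3 by (subst ln_le_cancel_iff) auto
      then have hH: "h \<le> H s" by (simp add: h_def H_def)
      have "ln (t * s) = x + ln s" using elim s3 by (simp add: x_def ln_mult)
      then have lv: "level d 2 (t * s) = d * x + h" by (simp add: level_def h_def algebra_simps)
      have "level d 2 (t * s) powr a - (d * ln t) powr a \<le> a * h * (d * x + h) powr (a - 1)"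
        unfolding lv x_def[symmetric] using x d a h by (intro powr_add_diff_le) auto
      also have "\<dots> \<le> a * H s * (d * s powr q + H s) powr (a - 1)"
        using a h hH d x xq by (intro mult_mono powr_mono2 add_mono mult_left_mono) auto
      also have "\<dots> \<le> s * (ln s - ln (2 * d) - 2)" by (rule S[OF s3(2)])
      finally show "level d 2 (t * s) powr a - (d * ln t) powr a \<le> s * (ln s - ln (2 * d) - 2)" .
    qed
  qed
qed

definition growth_ratio :: "real \<Rightarrow> (int ^ 'n \<Rightarrow> real) \<Rightarrow> real \<Rightarrow> real" where
  "growth_ratio a V t = (pam_growth V t - (real CARD('n) * ln t) powr a) /
     ((real CARD('n) * ln t) powr (a - 1) * ln (ln t))"

context linear_potential
begin

text \<open>
  The journey to \<open>z\<close> costs \<open>\<bar>z\<bar> ln m / t \<le> (ln t) powr b \<cdot> ln m\<close>, which is of smaller order than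
  \<open>(ln t) powr (a - 1)\<close> because \<open>b < a - 1\<close>. The limit is then that of the expansion of
  \<open>(d (x + b ln x) + \<kappa> ln (x + b ln x)) powr a\<close> around \<open>(d x) powr a\<close>, with \<open>x = ln t\<close>.
\<close>

lemma growth_ratio_ge:
  assumes a: "1 < a" and b: "0 < b" "b < a - 1" and "0 < \<delta>"
  shows "\<forall>\<^sub>F t in at_top.
    (\<exists>z. real (l1 z) \<le> t * ln t powr b \<and> level (real CARD('n)) \<kappa> (t * ln t powr b) powr a \<le> V z) \<longrightarrow>
      a * (real CARD('n) * b + \<kappa>) - \<delta> \<le> growth_ratio a V t"
proof -
  let ?d = "real CARD('n)"
  have d: "0 < ?d" by simp
  let ?m = "\<lambda>x. (?d * (x + b * ln x) + \<kappa> * ln (x + b * ln x)) powr a"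
  have "((\<lambda>x. (?m x - 2 * ?d - x powr b * ln (?m x) - ln 2 / exp x - (?d * x) powr a) /
      ((?d * x) powr (a - 1) * ln x)) \<longlongrightarrow> a * (?d * b + \<kappa>)) at_top"
    using a b d by real_asymp (simp add: powr_diff)
  from order_tendstoD(1)[OF this, of "a * (?d * b + \<kappa>) - \<delta>"] \<open>0 < \<delta>\<close>
  have "\<forall>\<^sub>F x in at_top. a * (?d * b + \<kappa>) - \<delta>
      < (?m x - 2 * ?d - x powr b * ln (?m x) - ln 2 / exp x - (?d * x) powr a) / ((?d * x) powr (a - 1) * ln x)"
    by simp
  moreover have "\<forall>\<^sub>F x in at_top. 1 \<le> ?m x"
    using a b d by real_asymp
  moreover have "\<forall>\<^sub>F x in at_top. 2 * (x powr b + 1) \<le> ?m x"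
    using a b d by real_asymp
  moreover have "\<forall>\<^sub>F x in at_top. 1 < (x :: real)"
    by (rule eventually_gt_at_top)
  ultimately have "\<forall>\<^sub>F x in at_top. a * (?d * b + \<kappa>) - \<delta>
      < (?m x - 2 * ?d - x powr b * ln (?m x) - ln 2 / exp x - (?d * x) powr a) / ((?d * x) powr (a - 1) * ln x)
      \<and> 1 \<le> ?m x \<and> 2 * (x powr b + 1) \<le> ?m x \<and> 1 < x"
    by eventually_elim blast
  from eventually_compose_filterlim[OF this ln_at_top] eventually_ge_at_top[of 1]
  show ?thesis
  proof eventually_elim
    case (elim t)
    define x where "x = ln t"
    define m where "m = ?m x"
    have lim: "a * (?d * b + \<kappa>) - \<delta>
       < (m - 2 * ?d - x powr b * ln m - ln 2 / t - (?d * x) powr a) / ((?d * x) powr (a - 1) * ln x)"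
      and m: "1 \<le> m" "2 * (x powr b + 1) \<le> m" and x: "1 < x" and t: "1 \<le> t"
      using elim by (auto simp: x_def m_def)
    have t1: "1 < t" using x t by (cases "t = 1") (auto simp: x_def)
    show ?case
    proof (intro impI, elim exE conjE)
      fix z assume z: "real (l1 z) \<le> t * ln t powr b" "level ?d \<kappa> (t * ln t powr b) powr a \<le> V z"
      have mz: "m \<le> V z"
        using z(2) level_scale[of t ?d \<kappa> b] t1 by (simp add: m_def x_def)
      have n: "real (l1 z) \<le> t * x powr b" using z(1) by (simp add: x_def)
      have "2 * (real (l1 z) + 1) \<le> t * (2 * (x powr b + 1))"
        using n t by (simp add: algebra_simps)
      also have "\<dots> \<le> t * m" using m t by (intro mult_left_mono) auto
      finally have large: "2 * (real (l1 z) + 1) \<le> t * m" .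
      have U: "exp (t * m - 2 * ?d * t - real (l1 z) * ln m) / 2 \<le> pam_total_mass V t"
        using t by (intro pam_total_mass_ge m(1) mz large) auto
      have "t * (m - 2 * ?d - x powr b * ln m - ln 2 / t) = t * m - 2 * ?d * t - (t * x powr b) * ln m - ln 2"
        using t by (simp add: algebra_simps)
      also have "\<dots> \<le> t * m - 2 * ?d * t - real (l1 z) * ln m - ln 2"
        using mult_right_mono[OF n, of "ln m"] m by simp
      also have "\<dots> = ln (exp (t * m - 2 * ?d * t - real (l1 z) * ln m) / 2)"
        by (simp add: ln_div)
      also have "\<dots> \<le> ln (pam_total_mass V t)"
        using U by (subst ln_le_cancel_iff) (auto intro: less_le_trans[OF _ U])
      finally have "m - 2 * ?d - x powr b * ln m - ln 2 / t \<le> pam_growth V t"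
        using t by (simp add: pam_growth_def le_divide_eq mult_ac)
      then have "(m - 2 * ?d - x powr b * ln m - ln 2 / t - (?d * x) powr a) / ((?d * x) powr (a - 1) * ln x)
          \<le> growth_ratio a V t"
        unfolding growth_ratio_def x_def[symmetric] using x by (intro divide_right_mono) auto
      then show "a * (?d * b + \<kappa>) - \<delta> \<le> growth_ratio a V t"
        using lim by linarith
    qed
  qed
qed

lemma pam_total_mass_pos:
  assumes "0 \<le> t"
  shows "0 < pam_total_mass V t"
proof -
  have "(\<Sum>k\<in>{0}. anderson_power V k 0 / fact k * t ^ k) \<le> (\<Sum>k. anderson_power V k 0 / fact k * t ^ k)"
    using assms by (intro sum_le_suminf summable_series) (auto simp: anderson_power_nonneg)
  then have "0 < (\<Sum>k. anderson_power V k 0 / fact k * t ^ k)" by simp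
  then have "0 < pam V t 0"
    using assms by (simp add: pam_eq pam_series_def anderson_series_def)
  also have "pam V t 0 \<le> pam_total_mass V t"
    using assms by (rule pam_le_total_mass)
  finally show ?thesis .
qed

text \<open>
  Numbers of jumps are of two kinds: for the first the potential seen is at most \<open>m\<close>, and the Poisson
  weights sum to \<open>1\<close>; for the second a geometric series gives at most \<open>2\<close>.
\<close>

lemma pam_total_mass_le_of_jump_bound:
  assumes t: "0 < t"
    and le: "\<And>n. peak V n \<le> m \<or> jump_bound t n \<le> exp (t * m - real n)"
  shows "pam_total_mass V t \<le> 3 * exp (t * m)"
proof -
  let ?D = "2 * real CARD('n)"
  have e: "(\<lambda>n. (?D * t) ^ n / fact n) sums exp (?D * t)"
    using exp_converges[of "?D * t"] by (simp add: field_simps)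
  have exp1: "exp (- 1 :: real) \<le> 1 / 2"
    using exp_ge_add_one_self[of 1] by (simp add: exp_minus field_simps)
  have g: "(\<lambda>n. exp (- 1 :: real) ^ n) sums (1 / (1 - exp (- 1)))"
    by (rule geometric_sums) simp
  have s: "(\<lambda>n. exp (t * m) * ((?D * t) ^ n / fact n + exp (- 1) ^ n)) sums
      (exp (t * m) * (exp (?D * t) + 1 / (1 - exp (- 1))))"
    by (intro sums_mult sums_add e g)
  have term_le: "jump_bound t n \<le> exp (t * m) * ((?D * t) ^ n / fact n + exp (- 1) ^ n)" for n
    using le[of n]
  proof
    assume "peak V n \<le> m"
    then have "jump_bound t n \<le> (?D * t) ^ n / fact n * exp (t * m)"
      unfolding jump_bound_def using t by (intro mult_left_mono) auto
    also have "\<dots> = exp (t * m) * ((?D * t) ^ n / fact n)" by (rule mult.commute)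
    also have "\<dots> \<le> exp (t * m) * ((?D * t) ^ n / fact n + exp (- 1) ^ n)"
      by (intro mult_left_mono) auto
    finally show ?thesis .
  next
    assume "jump_bound t n \<le> exp (t * m - real n)"
    also have "\<dots> = exp (t * m) * exp (- 1) ^ n"
      by (simp add: exp_diff exp_minus power_inverse flip: exp_of_nat_mult) (simp add: divide_inverse)
    also have "\<dots> \<le> exp (t * m) * ((?D * t) ^ n / fact n + exp (- 1) ^ n)"
      using t by (intro mult_left_mono) auto
    finally show ?thesis .
  qed
  have "pam_total_mass V t \<le> exp (- ?D * t) * (\<Sum>n. jump_bound t n)"
    using t by (intro pam_total_mass_le) auto
  also have "(\<Sum>n. jump_bound t n) \<le> exp (t * m) * (exp (?D * t) + 1 / (1 - exp (- 1)))"
    using t by (intro sums_le[OF term_le summable_sums[OF summable_jump_bound] s]) auto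
  also have "exp (- ?D * t) * \<dots> = exp (t * m) * (1 + exp (- ?D * t) * (1 / (1 - exp (- 1))))"
    by (simp add: algebra_simps exp_minus)
  also have "\<dots> \<le> exp (t * m) * (1 + 1 * 2)"
    using t exp1 by (intro mult_left_mono add_mono mult_mono) (auto simp: field_simps)
  finally show ?thesis by (simp add: mult_ac)
qed

text \<open>
  Up to \<open>t (ln t) powr b\<close> jumps the potential seen is at most the assumed level. Beyond, the crude
  almost sure bound with constant \<open>2\<close> holds and \<open>far_sites_negligible\<close> applies.
\<close>

lemma growth_ratio_le:
  assumes a: "1 < a" and b: "a - 1 < b" and "0 < \<delta>" and \<kappa>: "0 \<le> \<kappa>"
    and V2: "\<forall>\<^sub>F r in at_top. \<forall>z. real (l1 z) \<le> r \<longrightarrow> V z \<le> level (real CARD('n)) 2 r powr a"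
  shows "\<forall>\<^sub>F t in at_top.
    (\<forall>z. real (l1 z) \<le> t * ln t powr b \<longrightarrow> V z \<le> level (real CARD('n)) \<kappa> (t * ln t powr b) powr a) \<longrightarrow>
      growth_ratio a V t \<le> a * (real CARD('n) * b + \<kappa>) + \<delta>"
proof -
  let ?d = "real CARD('n)"
  have d: "0 < ?d" "1 \<le> ?d" by (auto simp: Suc_le_eq)
  have b0: "0 < b" using a b by simp
  obtain R where R: "\<And>r z. R \<le> r \<Longrightarrow> real (l1 z) \<le> r \<Longrightarrow> V z \<le> level ?d 2 r powr a"
    using V2 by (auto simp: eventually_at_top_linorder)
  let ?m = "\<lambda>x. (?d * (x + b * ln x) + \<kappa> * ln (x + b * ln x)) powr a"
  have "((\<lambda>x. (?m x + ln 3 / exp x - (?d * x) powr a) / ((?d * x) powr (a - 1) * ln x))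
      \<longlongrightarrow> a * (?d * b + \<kappa>)) at_top"
    using a b b0 d(1) by real_asymp (simp add: powr_diff)
  from order_tendstoD(2)[OF this, of "a * (?d * b + \<kappa>) + \<delta>"] \<open>0 < \<delta>\<close>
  have "\<forall>\<^sub>F x in at_top. (?m x + ln 3 / exp x - (?d * x) powr a) / ((?d * x) powr (a - 1) * ln x)
      < a * (?d * b + \<kappa>) + \<delta>"
    by simp
  moreover have "\<forall>\<^sub>F x in at_top. 1 < (x :: real)"
    by (rule eventually_gt_at_top)
  ultimately have "\<forall>\<^sub>F x in at_top. (?m x + ln 3 / exp x - (?d * x) powr a) / ((?d * x) powr (a - 1) * ln x)
      < a * (?d * b + \<kappa>) + \<delta> \<and> 1 < x"
    by eventually_elim blast
  from eventually_compose_filterlim[OF this ln_at_top] eventually_ge_at_top[of "max 1 R"]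
    far_sites_negligible[OF a b d(1)]
  show ?thesis
  proof eventually_elim
    case (elim t)
    define x where "x = ln t"
    define m where "m = ?m x"
    have lim: "(m + ln 3 / t - (?d * x) powr a) / ((?d * x) powr (a - 1) * ln x) < a * (?d * b + \<kappa>) + \<delta>"
      and x: "1 < x" and t: "1 \<le> t" "R \<le> t"
      using elim by (auto simp: x_def m_def)
    have t1: "1 < t" using x t by (cases "t = 1") (auto simp: x_def)
    have far: "level ?d 2 (t * s) powr a - (?d * x) powr a \<le> s * (ln s - ln (2 * ?d) - 2)"
      if "x powr b \<le> s" for s
      using elim(3) that by (simp add: x_def)
    have xb: "1 \<le> x powr b" using x b0 by (simp add: ge_one_powr_ge_zero)
    have lx: "0 < ln x" using x by simp
    have "?d * x \<le> ?d * (x + b * ln x) + \<kappa> * ln (x + b * ln x)"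
    proof -
      have "x \<le> x + b * ln x" using lx b0 by simp
      then have "?d * x \<le> ?d * (x + b * ln x)" "0 \<le> ln (x + b * ln x)"
        using x by (auto intro: mult_left_mono)
      then show ?thesis using \<kappa> by (simp add: add_increasing2)
    qed
    then have m_ge: "(?d * x) powr a \<le> m"
      unfolding m_def using a x by (intro powr_mono2) auto
    show ?case
    proof
      assume near: "\<forall>z. real (l1 z) \<le> t * ln t powr b \<longrightarrow> V z \<le> level ?d \<kappa> (t * ln t powr b) powr a"
      have near': "V z \<le> m" if "real (l1 z) \<le> t * x powr b" for z
        using near that level_scale[of t ?d \<kappa> b] t1 by (simp add: m_def x_def)
      have "pam_total_mass V t \<le> 3 * exp (t * m)"
      proof (rule pam_total_mass_le_of_jump_bound)
        fix n
        show "peak V n \<le> m \<or> jump_bound t n \<le> exp (t * m - real n)"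
        proof (cases "real n \<le> t * x powr b")
          case True
          then have "peak V n \<le> m"
            unfolding peak_le_iff by (auto intro!: near')
          then show ?thesis ..
        next
          case False
          define s where "s = real n / t"
          have s: "x powr b \<le> s" using False t by (simp add: s_def field_simps)
          then have s1: "1 \<le> s" using xb by simp
          have ts: "t * s = real n" using t by (simp add: s_def)
          have "t * 1 \<le> t * s" using s1 t by (intro mult_left_mono) auto
          then have n: "t \<le> real n" using ts by simp
          have n0: "0 < real n" using n t by linarith
          have "peak V n \<le> level ?d 2 (t * s) powr a"
            unfolding peak_le_iff ts using n t by (auto intro!: R)
          also have "\<dots> \<le> m + s * (ln s - ln (2 * ?d) - 2)"
            using far[OF s] m_ge by linarith
          finally have "t * peak V n \<le> t * (m + s * (ln s - ln (2 * ?d) - 2))"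
            using t by (intro mult_left_mono) auto
          also have "\<dots> = t * m + real n * (ln s - ln (2 * ?d) - 2)"
            using ts by (simp add: distrib_left mult.assoc[symmetric])
          finally have pk: "t * peak V n \<le> t * m + real n * (ln s - ln (2 * ?d) - 2)" .
          \<comment> \<open>Stirling: \<open>(2 d t)\<^sup>n / n!\<close> is at most \<open>(2 d e / s)\<^sup>n\<close>.\<close>
          have "2 * ?d * t = exp (ln (2 * ?d) - ln s) * real n"
            using s1 d ts n0 by (simp add: exp_diff s_def field_simps)
          then have "(2 * ?d * t) ^ n / fact n = exp (real n * (ln (2 * ?d) - ln s)) * (real n ^ n / fact n)"
            by (simp add: power_mult_distrib flip: exp_of_nat_mult)
          also have "\<dots> \<le> exp (real n * (ln (2 * ?d) - ln s)) * exp (real n)"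
            by (intro mult_left_mono power_over_fact_le) auto
          finally have "jump_bound t n \<le> (exp (real n * (ln (2 * ?d) - ln s)) * exp (real n)) *
              exp (t * m + real n * (ln s - ln (2 * ?d) - 2))"
            unfolding jump_bound_def using pk t by (intro mult_mono) auto
          also have "\<dots> = exp (t * m - real n)"
            by (simp add: algebra_simps flip: exp_add)
          finally show ?thesis ..
        qed
      qed (use t in auto)
      then have "ln (pam_total_mass V t) \<le> ln (3 * exp (t * m))"
        using pam_total_mass_pos[of t] t by (subst ln_le_cancel_iff) auto
      also have "\<dots> = (m + ln 3 / t) * t"
        using t by (simp add: ln_mult algebra_simps)
      finally have "pam_growth V t \<le> m + ln 3 / t"
        using t by (simp add: pam_growth_def divide_le_eq)
      then have "growth_ratio a V t \<le> (m + ln 3 / t - (?d * x) powr a) / ((?d * x) powr (a - 1) * ln x)"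
        unfolding growth_ratio_def x_def[symmetric] using x lx by (intro divide_right_mono) auto
      then show "growth_ratio a V t \<le> a * (?d * b + \<kappa>) + \<delta>"
        using lim by linarith
    qed
  qed
qed

end

section \<open>Limit superior and limit inferior\<close>

text \<open>
  Statements about infinitely many radii become statements about infinitely many times: the radius
  depends continuously on the time, hence takes every large value.
\<close>

lemma frequently_compose_continuous:
  fixes f :: "real \<Rightarrow> real"
  assumes cont: "continuous_on {c..} f" and lim: "filterlim f at_top at_top"
    and freq: "\<exists>\<^sub>F r in at_top. P r"
  shows "\<exists>\<^sub>F t in at_top. P (f t)"
  unfolding frequently_def
proof
  assume "\<forall>\<^sub>F t in at_top. \<not> P (f t)"
  then obtain T where T: "\<And>t. T \<le> t \<Longrightarrow> \<not> P (f t)"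
    by (auto simp: eventually_at_top_linorder)
  define T' where "T' = max T c"
  have "\<exists>\<^sub>F r in at_top. P r \<and> f T' \<le> r"
    using freq eventually_ge_at_top[of "f T'"] by (rule frequently_eventually_frequently)
  then obtain r where r: "P r" "f T' \<le> r"
    by (auto dest: frequently_ex)
  have "\<forall>\<^sub>F t in at_top. r \<le> f t \<and> T' \<le> t"
    using lim eventually_ge_at_top[of T'] by (auto simp: filterlim_at_top intro: eventually_conj)
  then obtain u where u: "r \<le> f u" "T' \<le> u"
    by (auto simp: eventually_at_top_linorder)
  have "continuous_on {T'..u} f"
    by (rule continuous_on_subset[OF cont]) (auto simp: T'_def)
  then obtain t where "T' \<le> t" "t \<le> u" "f t = r"
    using IVT'[of f T' r u] r u by auto
  then show False using T[of t] r by (auto simp: T'_def)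
qed

lemma filterlim_scale:
  assumes "0 < b"
  shows "filterlim (\<lambda>t::real. t * ln t powr b) at_top at_top"
  using assms by real_asymp

lemma continuous_on_scale: "continuous_on {2..} (\<lambda>t::real. t * ln t powr b)"
  by (intro continuous_intros) auto

lemma Limsup_ereal_eqI:
  fixes f :: "real \<Rightarrow> real"
  assumes up: "\<And>\<delta>. 0 < \<delta> \<Longrightarrow> \<forall>\<^sub>F t in at_top. f t \<le> c + \<delta>"
    and lo: "\<And>\<delta>. 0 < \<delta> \<Longrightarrow> \<exists>\<^sub>F t in at_top. c - \<delta> \<le> f t"
  shows "Limsup at_top (\<lambda>t. ereal (f t)) = ereal c"
proof (rule antisym)
  show "Limsup at_top (\<lambda>t. ereal (f t)) \<le> ereal c"
  proof (rule ereal_le_epsilon2)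
    fix \<delta> :: real assume "0 < \<delta>"
    then have "\<forall>\<^sub>F t in at_top. ereal (f t) \<le> ereal (c + \<delta>)" using up by simp
    from Limsup_bounded[OF this] show "Limsup at_top (\<lambda>t. ereal (f t)) \<le> ereal c + ereal \<delta>" by simp
  qed
  show "ereal c \<le> Limsup at_top (\<lambda>t. ereal (f t))"
  proof (rule ccontr)
    assume "\<not> ?thesis"
    then obtain y where y: "Limsup at_top (\<lambda>t. ereal (f t)) < ereal y" "ereal y < ereal c"
      using ereal_dense2 by (metis not_le)
    from Limsup_lessD[OF y(1)] have "\<forall>\<^sub>F t in at_top. f t < y" by simp
    moreover have "\<exists>\<^sub>F t in at_top. c - (c - y) \<le> f t" using y by (intro lo) simp
    ultimately have "\<exists>\<^sub>F t in at_top. y \<le> f t \<and> f t < y"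
      by (intro frequently_eventually_frequently) auto
    then show False by (auto dest: frequently_ex)
  qed
qed

lemma Liminf_ereal_eqI:
  fixes f :: "real \<Rightarrow> real"
  assumes lo: "\<And>\<delta>. 0 < \<delta> \<Longrightarrow> \<forall>\<^sub>F t in at_top. c - \<delta> \<le> f t"
    and up: "\<And>\<delta>. 0 < \<delta> \<Longrightarrow> \<exists>\<^sub>F t in at_top. f t \<le> c + \<delta>"
  shows "Liminf at_top (\<lambda>t. ereal (f t)) = ereal c"
proof -
  have "Limsup at_top (\<lambda>t. ereal (- f t)) = ereal (- c)"
  proof (rule Limsup_ereal_eqI)
    fix \<delta> :: real assume "0 < \<delta>"
    show "\<forall>\<^sub>F t in at_top. - f t \<le> - c + \<delta>"
      using lo[OF \<open>0 < \<delta>\<close>] by eventually_elim simp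
    show "\<exists>\<^sub>F t in at_top. - c - \<delta> \<le> - f t"
      using up[OF \<open>0 < \<delta>\<close>] by (rule frequently_elim1) simp
  qed
  then have "- Liminf at_top (\<lambda>t. ereal (f t)) = - ereal c"
    by (simp add: ereal_Limsup_uminus[symmetric])
  then show ?thesis by (simp only: ereal_uminus_eq_iff)
qed

text \<open>
  The deterministic core. The four properties say that the coefficient of \<open>ln ln r\<close> in the \<open>a\<close>-th root
  of the maximum over the ball of radius \<open>r\<close> has limit superior \<open>1\<close> and limit inferior \<open>0\<close>; the bounds on
  the growth rate translate this with \<open>b = a - 1 \<plusminus> \<epsilon>\<close>.
\<close>

theorem growth_ratio_limits:
  fixes V :: "int ^ 'n \<Rightarrow> real"
  assumes a: "1 < a" and nonneg: "\<And>z. 0 \<le> V z"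
    and ev_le: "\<And>\<epsilon>. 0 < \<epsilon> \<Longrightarrow>
      \<forall>\<^sub>F r in at_top. \<forall>z. real (l1 z) \<le> r \<longrightarrow> V z \<le> level (real CARD('n)) (1 + \<epsilon>) r powr a"
    and fr_ge: "\<exists>\<^sub>F r in at_top. \<exists>z. real (l1 z) \<le> r \<and> level (real CARD('n)) 1 r powr a \<le> V z"
    and ev_ge: "\<And>\<epsilon>. 0 < \<epsilon> \<Longrightarrow> \<epsilon> \<le> 1 \<Longrightarrow>
      \<forall>\<^sub>F r in at_top. \<exists>z. real (l1 z) \<le> r \<and> level (real CARD('n)) (- \<epsilon>) r powr a \<le> V z"
    and fr_le: "\<And>\<epsilon>. 0 < \<epsilon> \<Longrightarrow>
      \<exists>\<^sub>F r in at_top. \<forall>z. real (l1 z) \<le> r \<longrightarrow> V z \<le> level (real CARD('n)) \<epsilon> r powr a"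
  shows "Limsup at_top (\<lambda>t. ereal (growth_ratio a V t)) = ereal (a * (real CARD('n) * (a - 1) + 1))"
    and "Liminf at_top (\<lambda>t. ereal (growth_ratio a V t)) = ereal (a * (real CARD('n) * (a - 1)))"
proof -
  let ?d = "real CARD('n)"
  have d: "0 < ?d" by simp
  have V2: "\<forall>\<^sub>F r in at_top. \<forall>z. real (l1 z) \<le> r \<longrightarrow> V z \<le> level ?d 2 r powr a"
    using ev_le[of 1] by simp
  have "\<forall>\<^sub>F r in at_top. level ?d 2 r powr a \<le> r"
    unfolding level_def using a d by real_asymp
  with V2 have "\<forall>\<^sub>F r in at_top. \<forall>z. real (l1 z) \<le> r \<longrightarrow> V z \<le> r"
    by eventually_elim (meson order_trans)
  then obtain R where R: "\<And>r z. R \<le> r \<Longrightarrow> real (l1 z) \<le> r \<Longrightarrow> V z \<le> r"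
    by (auto simp: eventually_at_top_linorder)
  interpret linear_potential V "\<bar>R\<bar>" 1
  proof
    show "V z \<le> \<bar>R\<bar> + 1 * real (l1 z)" for z
      by (rule R) auto
  qed (use nonneg in auto)
  \<comment> \<open>Small enough for \<open>b = a - 1 - \<epsilon>\<close> to be positive, and for the errors in \<open>b\<close> and \<open>\<kappa>\<close> together to cost at most \<open>\<delta> / 2\<close>.\<close>
  define \<epsilon> where "\<epsilon> \<delta> = min (min 1 ((a - 1) / 2)) (\<delta> / (2 * a * (?d + 1)))" for \<delta>
  have e: "0 < \<epsilon> \<delta>" "\<epsilon> \<delta> \<le> 1" "\<epsilon> \<delta> < a - 1" "a * (?d * \<epsilon> \<delta> + \<epsilon> \<delta>) \<le> \<delta> / 2" if "0 < \<delta>" for \<delta>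
  proof -
    show "0 < \<epsilon> \<delta>" using that a by (simp add: \<epsilon>_def)
    show "\<epsilon> \<delta> \<le> 1" by (simp add: \<epsilon>_def)
    have "\<epsilon> \<delta> \<le> (a - 1) / 2" by (simp only: \<epsilon>_def min_le_iff_disj order_refl simp_thms)
    then show "\<epsilon> \<delta> < a - 1" using a by simp
    have "\<epsilon> \<delta> \<le> \<delta> / (2 * a * (?d + 1))" by (simp add: \<epsilon>_def)
    then have "a * (?d + 1) * \<epsilon> \<delta> \<le> a * (?d + 1) * (\<delta> / (2 * a * (?d + 1)))"
      using a by (intro mult_left_mono) auto
    also have "\<dots> = \<delta> / 2"
    proof -
      have cancel: "c * (\<delta> / (2 * c)) = \<delta> / 2" if "c \<noteq> 0" for c :: real using that by simp
      have "a * (?d + 1) \<noteq> 0" using a d by simp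
      from cancel[OF this] show ?thesis by (simp only: mult.assoc)
    qed
    finally show "a * (?d * \<epsilon> \<delta> + \<epsilon> \<delta>) \<le> \<delta> / 2" by (simp add: algebra_simps)
  qed
  have upper: "\<forall>\<^sub>F t in at_top.
      (\<forall>z. real (l1 z) \<le> t * ln t powr (a - 1 + \<epsilon> \<delta>) \<longrightarrow>
        V z \<le> level ?d (\<kappa> + \<epsilon> \<delta>) (t * ln t powr (a - 1 + \<epsilon> \<delta>)) powr a) \<longrightarrow>
      growth_ratio a V t \<le> a * (?d * (a - 1) + \<kappa>) + \<delta>" if "0 < \<delta>" "0 \<le> \<kappa>" for \<delta> \<kappa>
    using growth_ratio_le[OF a, of "a - 1 + \<epsilon> \<delta>" "\<delta> / 2" "\<kappa> + \<epsilon> \<delta>", OF _ _ _ V2] e[OF that(1)] that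
    by (auto simp: algebra_simps elim!: eventually_mono)
  have lower: "\<forall>\<^sub>F t in at_top.
      (\<exists>z. real (l1 z) \<le> t * ln t powr (a - 1 - \<epsilon> \<delta>) \<and>
        level ?d (\<kappa> - \<epsilon>') (t * ln t powr (a - 1 - \<epsilon> \<delta>)) powr a \<le> V z) \<longrightarrow>
      a * (?d * (a - 1) + \<kappa>) - \<delta> \<le> growth_ratio a V t" if "0 < \<delta>" "\<epsilon>' \<le> \<epsilon> \<delta>" for \<delta> \<kappa> \<epsilon>'
  proof -
    have "a * \<epsilon>' \<le> a * \<epsilon> \<delta>" using that a by (intro mult_left_mono) auto
    then have "a * (?d * (a - 1) + \<kappa>) - \<delta> \<le> a * (?d * (a - 1 - \<epsilon> \<delta>) + (\<kappa> - \<epsilon>')) - \<delta> / 2"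
      using e(4)[OF that(1)] unfolding distrib_left right_diff_distrib by linarith
    moreover have "\<forall>\<^sub>F t in at_top.
      (\<exists>z. real (l1 z) \<le> t * ln t powr (a - 1 - \<epsilon> \<delta>) \<and>
        level ?d (\<kappa> - \<epsilon>') (t * ln t powr (a - 1 - \<epsilon> \<delta>)) powr a \<le> V z) \<longrightarrow>
      a * (?d * (a - 1 - \<epsilon> \<delta>) + (\<kappa> - \<epsilon>')) - \<delta> / 2 \<le> growth_ratio a V t"
      using e[OF that(1)] that by (intro growth_ratio_ge a) auto
    ultimately show ?thesis
      by (auto elim!: eventually_mono intro: order_trans)
  qed
  show "Limsup at_top (\<lambda>t. ereal (growth_ratio a V t)) = ereal (a * (?d * (a - 1) + 1))"
  proof (rule Limsup_ereal_eqI)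
    fix \<delta> :: real assume \<delta>: "0 < \<delta>"
    note e = e[OF \<delta>]
    have "0 < a - 1 + \<epsilon> \<delta>" using e a by simp
    from eventually_compose_filterlim[OF ev_le[OF e(1)] filterlim_scale[OF this]]
    show "\<forall>\<^sub>F t in at_top. growth_ratio a V t \<le> a * (?d * (a - 1) + 1) + \<delta>"
      by (rule eventually_mp[OF upper[OF \<delta> zero_le_one]])
    have "0 < a - 1 - \<epsilon> \<delta>" using e by simp
    from frequently_eventually_frequently[OF frequently_compose_continuous[OF continuous_on_scale filterlim_scale[OF this] fr_ge]
        lower[OF \<delta>, of 0 1]]
    show "\<exists>\<^sub>F t in at_top. a * (?d * (a - 1) + 1) - \<delta> \<le> growth_ratio a V t"
      using e by (auto elim!: frequently_elim1)
  qed
  show "Liminf at_top (\<lambda>t. ereal (growth_ratio a V t)) = ereal (a * (?d * (a - 1)))"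
  proof (rule Liminf_ereal_eqI)
    fix \<delta> :: real assume \<delta>: "0 < \<delta>"
    note e = e[OF \<delta>]
    have "0 < a - 1 - \<epsilon> \<delta>" using e by simp
    from eventually_compose_filterlim[OF ev_ge[OF e(1,2)] filterlim_scale[OF this]]
    show "\<forall>\<^sub>F t in at_top. a * (?d * (a - 1)) - \<delta> \<le> growth_ratio a V t"
      using lower[OF \<delta> order_refl, of 0] by (simp add: eventually_mp)
    have "0 < a - 1 + \<epsilon> \<delta>" using e a by simp
    from frequently_eventually_frequently[OF frequently_compose_continuous[OF continuous_on_scale filterlim_scale[OF this] fr_le[OF e(1)]]
        upper[OF \<delta>, of 0]]
    show "\<exists>\<^sub>F t in at_top. growth_ratio a V t \<le> a * (?d * (a - 1)) + \<delta>"
      by (auto elim!: frequently_elim1)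
  qed
qed

context weibull_field
begin

text \<open>
  Exceptional sets may depend on \<open>\<epsilon>\<close>; by monotonicity the countably many values \<open>1 / (m + 1)\<close> suffice.
\<close>

lemma AE_all_pos_of_mono:
  fixes P :: "real \<Rightarrow> 'w \<Rightarrow> bool"
  assumes "\<And>\<epsilon>. 0 < \<epsilon> \<Longrightarrow> \<epsilon> \<le> 1 \<Longrightarrow> AE \<omega> in M. P \<epsilon> \<omega>"
    and "\<And>\<epsilon> \<epsilon>' \<omega>. 0 < \<epsilon> \<Longrightarrow> \<epsilon> \<le> \<epsilon>' \<Longrightarrow> P \<epsilon> \<omega> \<Longrightarrow> P \<epsilon>' \<omega>"
  shows "AE \<omega> in M. \<forall>\<epsilon>>0. P \<epsilon> \<omega>"
proof -
  have "AE \<omega> in M. P (inverse (real (Suc m))) \<omega>" for m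
    by (rule assms(1)) (auto simp: inverse_eq_divide)
  then have "AE \<omega> in M. \<forall>m. P (inverse (real (Suc m))) \<omega>"
    unfolding AE_all_countable by blast
  then show ?thesis
  proof eventually_elim
    case (elim \<omega>)
    show ?case
    proof (intro allI impI)
      fix \<epsilon> :: real assume "0 < \<epsilon>"
      then obtain m where "inverse (real (Suc m)) < \<epsilon>" using reals_Archimedean by blast
      then show "P \<epsilon> \<omega>"
        using elim assms(2)[of "inverse (real (Suc m))" \<epsilon> \<omega>] by auto
    qed
  qed
qed

lemma level_powr_mono:
  assumes "3 \<le> r" "- 1 \<le> c" "c \<le> c'"
  shows "level (real CARD('n)) c r powr (1 / \<gamma>) \<le> level (real CARD('n)) c' r powr (1 / \<gamma>)"
proof -
  have "1 \<le> ln r" using ln_ge_1 assms by simp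
  then have "level (real CARD('n)) c r \<le> level (real CARD('n)) c' r"
    using assms by (auto simp: level_def intro: mult_right_mono)
  then show ?thesis
    using \<gamma>_pos assms dim_ge_1 by (intro powr_mono2 level_nonneg) auto
qed

theorem AE_growth_ratio_limits:
  assumes "\<gamma> < 1"
  shows "AE \<omega> in M.
     Limsup at_top (\<lambda>t. ereal (growth_ratio (1 / \<gamma>) (\<lambda>z. \<xi> z \<omega>) t))
       = ereal (1 / \<gamma> * (real CARD('n) * (1 / \<gamma> - 1) + 1)) \<and>
     Liminf at_top (\<lambda>t. ereal (growth_ratio (1 / \<gamma>) (\<lambda>z. \<xi> z \<omega>) t))
       = ereal (1 / \<gamma> * (real CARD('n) * (1 / \<gamma> - 1)))"
proof -
  let ?l = "\<lambda>c r. level (real CARD('n)) c r powr (1 / \<gamma>)"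
  have a: "1 < 1 / \<gamma>" using assms \<gamma>_pos by simp
  have 1: "AE \<omega> in M. \<forall>\<epsilon>>0. \<forall>\<^sub>F r in at_top. \<forall>z. real (l1 z) \<le> r \<longrightarrow> \<xi> z \<omega> \<le> ?l (1 + \<epsilon>) r"
  proof (rule AE_all_pos_of_mono)
    fix \<epsilon> \<epsilon>' :: real and \<omega>
    assume "0 < \<epsilon>" "\<epsilon> \<le> \<epsilon>'" and ev: "\<forall>\<^sub>F r in at_top. \<forall>z. real (l1 z) \<le> r \<longrightarrow> \<xi> z \<omega> \<le> ?l (1 + \<epsilon>) r"
    then have le: "?l (1 + \<epsilon>) r \<le> ?l (1 + \<epsilon>') r" if "3 \<le> r" for r
      using level_powr_mono[OF that] by simp
    show "\<forall>\<^sub>F r in at_top. \<forall>z. real (l1 z) \<le> r \<longrightarrow> \<xi> z \<omega> \<le> ?l (1 + \<epsilon>') r"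
      using ev eventually_ge_at_top[of 3] by eventually_elim (use le order_trans in blast)
  qed (rule AE_eventually_below)
  have 2: "AE \<omega> in M. \<forall>\<epsilon>>0. \<exists>\<^sub>F r in at_top. \<forall>z. real (l1 z) \<le> r \<longrightarrow> \<xi> z \<omega> \<le> ?l \<epsilon> r"
  proof (rule AE_all_pos_of_mono)
    fix \<epsilon> \<epsilon>' :: real and \<omega>
    assume "0 < \<epsilon>" "\<epsilon> \<le> \<epsilon>'" and ev: "\<exists>\<^sub>F r in at_top. \<forall>z. real (l1 z) \<le> r \<longrightarrow> \<xi> z \<omega> \<le> ?l \<epsilon> r"
    then have le: "?l \<epsilon> r \<le> ?l \<epsilon>' r" if "3 \<le> r" for r
      using level_powr_mono[OF that] by simp
    show "\<exists>\<^sub>F r in at_top. \<forall>z. real (l1 z) \<le> r \<longrightarrow> \<xi> z \<omega> \<le> ?l \<epsilon>' r"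
      using frequently_eventually_frequently[OF ev eventually_ge_at_top[of 3]]
      by (rule frequently_elim1) (use le order_trans in blast)
  qed (rule AE_frequently_below)
  have 3: "AE \<omega> in M. \<forall>\<epsilon>>0. \<epsilon> \<le> 1 \<longrightarrow> (\<forall>\<^sub>F r in at_top. \<exists>z. real (l1 z) \<le> r \<and> ?l (- \<epsilon>) r \<le> \<xi> z \<omega>)"
  proof (rule AE_all_pos_of_mono)
    fix \<epsilon> \<epsilon>' :: real and \<omega>
    assume e: "0 < \<epsilon>" "\<epsilon> \<le> \<epsilon>'"
      and ev: "\<epsilon> \<le> 1 \<longrightarrow> (\<forall>\<^sub>F r in at_top. \<exists>z. real (l1 z) \<le> r \<and> ?l (- \<epsilon>) r \<le> \<xi> z \<omega>)"
    show "\<epsilon>' \<le> 1 \<longrightarrow> (\<forall>\<^sub>F r in at_top. \<exists>z. real (l1 z) \<le> r \<and> ?l (- \<epsilon>') r \<le> \<xi> z \<omega>)"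
    proof
      assume e1: "\<epsilon>' \<le> 1"
      have le: "?l (- \<epsilon>') r \<le> ?l (- \<epsilon>) r" if "3 \<le> r" for r
        using level_powr_mono[OF that] e e1 by simp
      have "\<forall>\<^sub>F r in at_top. \<exists>z. real (l1 z) \<le> r \<and> ?l (- \<epsilon>) r \<le> \<xi> z \<omega>"
        using ev e e1 by simp
      then show "\<forall>\<^sub>F r in at_top. \<exists>z. real (l1 z) \<le> r \<and> ?l (- \<epsilon>') r \<le> \<xi> z \<omega>"
        using eventually_ge_at_top[of 3] by eventually_elim (use le order_trans in blast)
    qed
  qed (use AE_eventually_above in auto)
  show ?thesis
    using AE_nonneg 1 2 3 AE_frequently_above
  proof eventually_elim
    case (elim \<omega>)
    show ?case
      by (intro conjI growth_ratio_limits[OF a]) (use elim in blast)+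
  qed
qed

end

theorem theorem1p3:
  fixes M :: "'w measure"
    and \<xi> :: "int ^ 'n \<Rightarrow> 'w \<Rightarrow> real"
    and \<gamma> d :: real
  assumes "prob_space M"
    and "0 < \<gamma>" and "\<gamma> < 1"
    and d: "d = real CARD('n)"
    and indep: "prob_space.indep_vars M (\<lambda>_. borel) \<xi> UNIV"
    and distr: "\<And>z x. measure M {\<omega> \<in> space M. \<xi> z \<omega> \<le> x} =
                  (if x \<ge> 0 then 1 - exp (- (x powr \<gamma>)) else 0)"
  shows "AE \<omega> in M.
     Limsup at_top (\<lambda>t::real. ereal
         ((pam_growth (\<lambda>z. \<xi> z \<omega>) t - (d * ln t) powr (1 / \<gamma>)) /
          ((d * ln t) powr (1 / \<gamma> - 1) * ln (ln t))))
       = ereal (d * (1 / \<gamma>\<^sup>2 - 1 / \<gamma>) + 1 / \<gamma>) \<and>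
     Liminf at_top (\<lambda>t::real. ereal
         ((pam_growth (\<lambda>z. \<xi> z \<omega>) t - (d * ln t) powr (1 / \<gamma>)) /
          ((d * ln t) powr (1 / \<gamma> - 1) * ln (ln t))))
       = ereal (d * (1 / \<gamma>\<^sup>2 - 1 / \<gamma>))"
proof -
  interpret weibull_field M \<xi> \<gamma>
    using assms(1) by (rule weibull_field.intro) (unfold_locales, fact+)
  have "1 / \<gamma> * (real CARD('n) * (1 / \<gamma> - 1)) = d * (1 / \<gamma>\<^sup>2 - 1 / \<gamma>)"
    by (simp add: d power2_eq_square algebra_simps)
  moreover from this have "1 / \<gamma> * (real CARD('n) * (1 / \<gamma> - 1) + 1) = d * (1 / \<gamma>\<^sup>2 - 1 / \<gamma>) + 1 / \<gamma>"
    by (simp add: algebra_simps)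
  ultimately show ?thesis
    using AE_growth_ratio_limits[OF assms(3)] by (simp only: growth_ratio_def d)
qed

end
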